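(* Let $q\in L^1_{\mathbb{R}}[0,\pi]$, and suppose that either $\alpha,\beta\in(0,\pi)$, or $\alpha=\pi$ and $\beta=0$. For $n\ge2$ put $$\varkappa_n=\varkappa_n(q,\alpha,\beta)=-\frac12\int_0^\pi(\pi-t)\,q(t)\,\sin\bigl(2[n+\delta_n(\alpha,\beta)]t\bigr)\,dt .$$ Then the function $k$ defined as the series $$k(x)=\sum_{n=2}^{\infty}\frac{\varkappa_n}{n+\delta_n(\alpha,\beta)}\cos\bigl([n+\delta_n(\alpha,\beta)]x\bigr)$$ is absolutely continuous on every segment $[a,b]\subset(0,2\pi)$, i.e. $k\in AC(0,2\pi)$.
   Context: $L^1_{\mathbb{R}}[0,\pi]$ is the space of real-valued summable (Lebesgue integrable) functions on $[0,\pi]$. $AC(0,2\pi)$ denotes the functions on $(0,2\pi)$ that are absolutely continuous on every closed segment $[a,b]\subset(0,2\pi)$. For $\alpha\in(0,\pi]$, $\beta\in[0,\pi)$ and $n\ge 2$, $\delta_n=\delta_n(\alpha,\beta)$ is the solution of the equation $$\delta_n=\frac1\pi\arccos\frac{\cos\alpha}{\sqrt{(n+\delta_n)^2\sin^2\alpha+\cos^2\alpha}}-\frac1\pi\arccos\frac{\cos\beta}{\sqrt{(n+\delta_n)^2\sin^2\beta+\cos^2\beta}}.$$ In particular $\delta_n(\pi,0)=1$, and for $\alpha,\beta\in(0,\pi)$ one has $\delta_n(\alpha,\beta)=\frac{\cot\beta-\cot\alpha}{\pi n}+O(1/n^2)$ as $n\to\infty$. *)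

theory Defs
  imports "HOL-Analysis.Analysis"
begin

definition delta_rhs :: "real \<Rightarrow> real \<Rightarrow> nat \<Rightarrow> real \<Rightarrow> real" where
  "delta_rhs \<alpha> \<beta> n d =
     1 / pi * arccos (cos \<alpha> / sqrt ((real n + d)\<^sup>2 * (sin \<alpha>)\<^sup>2 + (cos \<alpha>)\<^sup>2))
   - 1 / pi * arccos (cos \<beta> / sqrt ((real n + d)\<^sup>2 * (sin \<beta>)\<^sup>2 + (cos \<beta>)\<^sup>2))"

(* The description is well defined for 0 < \<alpha> \<le> pi, 0 \<le> \<beta> < pi and n \<ge> 2: the right-hand
   side takes values in [-1, 1], and for n + d \<ge> 1 each arccos term has derivative in d of absolute
   value at most 1 / (2 * (n + d)), so that delta_rhs \<alpha> \<beta> n is a contraction of [-1, 1]. *)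
definition delta :: "real \<Rightarrow> real \<Rightarrow> nat \<Rightarrow> real" where
  "delta \<alpha> \<beta> n = (THE d. d = delta_rhs \<alpha> \<beta> n d)"

definition kappa :: "(real \<Rightarrow> real) \<Rightarrow> real \<Rightarrow> real \<Rightarrow> nat \<Rightarrow> real" where
  "kappa q \<alpha> \<beta> n =
     - (1 / 2) * (LINT t:{0..pi}|lebesgue. (pi - t) * q t * sin (2 * (real n + delta \<alpha> \<beta> n) * t))"

definition k_term :: "(real \<Rightarrow> real) \<Rightarrow> real \<Rightarrow> real \<Rightarrow> nat \<Rightarrow> real \<Rightarrow> real" where
  "k_term q \<alpha> \<beta> n x =
     kappa q \<alpha> \<beta> n / (real n + delta \<alpha> \<beta> n) * cos ((real n + delta \<alpha> \<beta> n) * x)"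

definition k_fun :: "(real \<Rightarrow> real) \<Rightarrow> real \<Rightarrow> real \<Rightarrow> real \<Rightarrow> real" where
  "k_fun q \<alpha> \<beta> x = (\<Sum>m. k_term q \<alpha> \<beta> (m + 2) x)"

(* Absolute continuity of a function on a segment; unrelated to the library's
   absolutely_continuous, which is a relation between measures. *)
definition abs_continuous_on_segment :: "(real \<Rightarrow> real) \<Rightarrow> real \<Rightarrow> real \<Rightarrow> bool" where
  "abs_continuous_on_segment f a b \<longleftrightarrow>
     (\<forall>\<epsilon>>0. \<exists>\<eta>>0. \<forall>(N::nat) (u::nat \<Rightarrow> real) (v::nat \<Rightarrow> real).
        (\<forall>i<N. a \<le> u i \<and> u i \<le> v i \<and> v i \<le> b) \<longrightarrow>
        disjoint_family_on (\<lambda>i. {u i<..<v i}) {..<N} \<longrightarrow>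
        (\<Sum>i<N. v i - u i) < \<eta> \<longrightarrow>
        (\<Sum>i<N. \<bar>f (v i) - f (u i)\<bar>) < \<epsilon>)"

definition AC_open :: "real \<Rightarrow> real \<Rightarrow> (real \<Rightarrow> real) set" where
  "AC_open c d = {f. \<forall>a b. c < a \<longrightarrow> a \<le> b \<longrightarrow> b < d \<longrightarrow> abs_continuous_on_segment f a b}"

end

theory Submission
  imports Defs "HOL-Real_Asymp.Real_Asymp"
begin

text \<open>
  Put \<open>h t = (pi - t) q t\<close> on \<open>[0, pi]\<close> and \<open>\<omega>\<^sub>n = n + \<delta>\<^sub>n\<close>. The product formula for sine and cosine gives
  \<open>k x = - 1/4 \<integral> h t (\<Psi> (2 t + x) + \<Psi> (2 t - x)) dt\<close> with \<open>\<Psi> y = \<Sum>\<^sub>n sin (\<omega>\<^sub>n y) / \<omega>\<^sub>n\<close>; the interchange is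
  dominated convergence, since the partial sums of \<open>\<Psi>\<close> are uniformly bounded on bounded sets.
  The function \<open>\<Psi>\<close> is the sawtooth \<open>\<Sum>\<^sub>n sin (n y) / n\<close> plus a locally Lipschitz function: as
  \<open>\<omega>\<^sub>n = n + c / n + O(1 / n\<^sup>2)\<close>, the differentiated difference has the terms
  \<open>cos (\<omega>\<^sub>n y) - cos (n y) = - c y sin (n y) / n + O(1 / n\<^sup>2)\<close>, whose partial sums are bounded again.
  (For \<open>\<alpha> = pi\<close>, \<open>\<beta> = 0\<close> one has \<open>\<omega>\<^sub>n = n + 1\<close>, and the difference is a trigonometric polynomial.)
  The Lipschitz part contributes a Lipschitz function of \<open>x\<close>. The jumps of the sawtooth, at
  \<open>t = x / 2\<close> and \<open>t = pi - x / 2\<close> for \<open>0 < x < 2 pi\<close>, contribute integrals of \<open>h\<close> over intervals whose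
  endpoints are affine in \<open>x\<close>, and these are absolutely continuous because \<open>h\<close> is integrable.
\<close>

section \<open>The sawtooth series\<close>

text \<open>The mean value theorem on [0, z/2], where cosine is at least sqrt 2 / 2, and the
  double-angle formula each contribute a factor sqrt 2 / 2. The bound keeps sin (y/2) away from 0 in
  \<open>saw_sum_bounded\<close>.\<close>

lemma sin_ge_half:
  assumes "0 \<le> z" "z \<le> pi / 2" shows "z / 2 \<le> sin z"
proof -
  have q: "cos (z/2) \<ge> sqrt 2 / 2"
  proof -
    have "cos (z/2) \<ge> cos (pi/4)" using assms by (intro cos_monotone_0_pi_le) auto
    thus ?thesis by (simp add: cos_45)
  qed
  have s: "sin (z/2) \<ge> z/2 * (sqrt 2 / 2)"
  proof (cases "z = 0")
    case False
    have "\<exists>x. 0 < x \<and> x < z/2 \<and> sin (z/2) - sin 0 = (z/2 - 0) * cos x"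
      using False assms by (intro MVT2) (auto intro!: derivative_eq_intros)
    then obtain x where x: "0 < x" "x < z/2" "sin (z/2) = (z/2) * cos x" by auto
    have "cos x \<ge> cos (z/2)" using x assms by (intro cos_monotone_0_pi_le) auto
    hence "z/2 * (sqrt 2 / 2) \<le> z/2 * cos x" using q assms by (intro mult_left_mono) auto
    thus ?thesis by (simp only: x(3))
  qed auto
  have "sin z = 2 * sin (z/2) * cos (z/2)" using sin_double[of "z/2"] by simp
  also have "\<dots> \<ge> 2 * (z/2 * (sqrt 2 / 2)) * (sqrt 2 / 2)"
    using s q assms by (intro mult_mono) (auto intro: sin_ge_zero)
  also have "2 * (z/2 * (sqrt 2 / 2)) * (sqrt 2 / 2) = z / 2" by (simp add: field_simps)
  finally show ?thesis .
qed

text \<open>Each product 2 sin cos is a difference of two sines, and these telescope. In the form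
  without division by sin (y/2) the identity holds at every y.\<close>

lemma dirichlet_kernel:
  "2 * sin (y/2) * (\<Sum>m<N. cos (real (Suc m) * y)) + sin (y/2) = sin ((2 * real N + 1) * y / 2)"
proof (induction N)
  case (Suc N)
  have "2 * sin (y/2) * cos (real (Suc N) * y) =
      sin (y/2 + real (Suc N) * y) + sin (y/2 - real (Suc N) * y)"
    by (simp add: sin_add sin_diff)
  also have "y/2 - real (Suc N) * y = - ((2 * real N + 1) * y / 2)" by (simp add: field_simps)
  also have "y/2 + real (Suc N) * y = (2 * real (Suc N) + 1) * y / 2" by (simp add: field_simps)
  finally show ?case using Suc by (simp only: sum.lessThan_Suc sin_minus distrib_left)
qed auto

definition saw_sum :: "nat \<Rightarrow> real \<Rightarrow> real" where
  "saw_sum N y = (\<Sum>m<N. sin (real (Suc m) * y) / real (Suc m))"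

lemma saw_sum_minus: "saw_sum N (- y) = - saw_sum N y"
  by (simp add: saw_sum_def sum_negf)

lemma saw_sum_periodic: "saw_sum N (y + 2 * pi * of_int k) = saw_sum N y"
proof -
  have "sin (real (Suc m) * (y + 2 * pi * of_int k)) = sin (real (Suc m) * y)" for m
  proof -
    have "real (Suc m) * (y + 2 * pi * of_int k) = real (Suc m) * y + 2 * pi * of_int (int (Suc m) * k)"
      by (simp add: algebra_simps)
    thus ?thesis by (simp add: sin_add sin_int_2pin cos_int_2pin del: of_int_mult)
  qed
  thus ?thesis by (simp add: saw_sum_def)
qed

text \<open>The correction term in \<open>F\<close> comes from one integration by parts of the Dirichlet kernel; it
  reduces \<open>F'\<close> to order \<open>1 / N\<close>, dominated by \<open>- G'\<close>.\<close>

lemma saw_sum_error_half: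
  assumes y: "0 < y" "y \<le> pi"
  shows "\<bar>saw_sum N y - (pi - y) / 2\<bar> \<le> 2 / ((2 * real N + 1) * sin (y / 2))"
proof -
  define M where "M = 2 * real N + 1"
  have M: "M > 0" by (simp add: M_def)
  define F where "F = (\<lambda>y. saw_sum N y - (pi - y) / 2 + cos (M * y / 2) / (M * sin (y / 2)))"
  \<comment> \<open>\<open>G\<close> is cot (y/2) / M. It is chosen so that minus its derivative is
    exactly the bound for \<open>F'\<close> that remains once the two cosines in the numerator are
    estimated by 1.\<close>
  define G where "G = (\<lambda>y. cos (y / 2) / (M * sin (y / 2)))"
  have sp: "sin (z / 2) > 0" if "y \<le> z" "z \<le> pi" for z
    using that y by (intro sin_gt_zero) auto
  define F' where "F' = (\<lambda>z. - cos (M * z / 2) * cos (z / 2) / (2 * M * (sin (z / 2))\<^sup>2))"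
  define G' where "G' = (\<lambda>z. - 1 / (2 * M * (sin (z / 2))\<^sup>2))"
  have dS: "(saw_sum N has_real_derivative (\<Sum>m<N. cos (real (Suc m) * z))) (at z)" for z
    unfolding saw_sum_def [abs_def]
    by (auto intro!: derivative_eq_intros sum.cong simp: field_simps simp del: of_nat_Suc)
  have dF: "(F has_real_derivative F' z) (at z)" if z: "y \<le> z" "z \<le> pi" for z
  proof -
    let ?s = "sin (z/2)" and ?c = "cos (z/2)" and ?S = "sin (M*z/2)" and ?C = "cos (M*z/2)"
    have s: "?s > 0" using sp z by simp
    have D: "(F has_real_derivative (\<Sum>m<N. cos (real (Suc m) * z)) + 1/2 +
       (- ?S * (M / 2) * (M * ?s) - ?C * (M * (?c / 2))) / ((M * ?s) * (M * ?s))) (at z)"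
      unfolding F_def
      using s M by (auto intro!: derivative_eq_intros dS simp: field_simps)
    have k: "(\<Sum>m<N. cos (real (Suc m) * z)) + 1/2 = ?S / (2 * ?s)"
      using dirichlet_kernel[of z N] s unfolding M_def by (simp add: field_simps)
    have "?S / (2 * ?s) + (- ?S * (M / 2) * (M * ?s) - ?C * (M * (?c / 2))) / ((M * ?s) * (M * ?s)) = F' z"
      unfolding F'_def using s M by (simp add: field_simps power2_eq_square)
    thus ?thesis using D k by simp
  qed
  have dG: "(G has_real_derivative G' z) (at z)" if z: "y \<le> z" "z \<le> pi" for z
  proof -
    let ?s = "sin (z/2)" and ?c = "cos (z/2)"
    have s: "?s > 0" using sp z by simp
    have D: "(G has_real_derivative 
       ((- ?s / 2) * (M * ?s) - ?c * (M * (?c / 2))) / ((M * ?s) * (M * ?s))) (at z)"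
      unfolding G_def
      using s M by (auto intro!: derivative_eq_intros simp: field_simps)
    have "(- ?s / 2) * (M * ?s) - ?c * (M * (?c / 2)) = - (M / 2) * (?s\<^sup>2 + ?c\<^sup>2)"
      by algebra
    also have "\<dots> = - (M / 2)" by simp
    finally have "((- ?s / 2) * (M * ?s) - ?c * (M * (?c / 2))) / ((M * ?s) * (M * ?s)) =
        - (M / 2) / ((M * ?s) * (M * ?s))" by (simp only:)
    also have "\<dots> = G' z"
      unfolding G'_def using s M by (simp add: field_simps power2_eq_square)
    finally show ?thesis using D by simp
  qed
  have FG: "\<bar>F' z\<bar> \<le> - G' z" for z
  proof -
    have "\<bar>cos (M * z / 2) * cos (z / 2)\<bar> \<le> 1"
      unfolding abs_mult by (intro mult_le_one) auto
    thus ?thesis using M unfolding F'_def G'_def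
      by (simp add: abs_mult divide_right_mono)
  qed
  \<comment> \<open>At pi all sines vanish, and the correction term vanishes as well because
    \<open>M\<close> is odd. So both \<open>F\<close> and \<open>G\<close> are 0 there.\<close>
  have "saw_sum N pi = 0"
    unfolding saw_sum_def by (auto intro!: sum.neutral simp: sin_npi simp del: of_nat_Suc)
  moreover have "cos (M * pi / 2) = 0"
  proof -
    have "M * pi / 2 = real N * pi + pi / 2" by (simp add: M_def field_simps)
    thus ?thesis by (simp only: cos_add sin_npi) simp
  qed
  ultimately have F0: "F pi = 0" and G0: "G pi = 0" by (auto simp: F_def G_def)
  \<comment> \<open>\<open>G - F\<close> and \<open>G + F\<close> are nonincreasing on [y, pi] and
    vanish at pi, so both are nonnegative at y.\<close>
  have "(\<lambda>z. G z - F z) y \<ge> (\<lambda>z. G z - F z) pi"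
  proof (rule DERIV_nonpos_imp_nonincreasing[OF y(2)])
    fix z assume "y \<le> z" "z \<le> pi"
    thus "\<exists>D. ((\<lambda>z. G z - F z) has_real_derivative D) (at z) \<and> D \<le> 0"
      using dF dG FG[of z] by (intro exI[of _ "G' z - F' z"]) (auto intro!: derivative_eq_intros)
  qed
  moreover have "(\<lambda>z. G z + F z) y \<ge> (\<lambda>z. G z + F z) pi"
  proof (rule DERIV_nonpos_imp_nonincreasing[OF y(2)])
    fix z assume "y \<le> z" "z \<le> pi"
    thus "\<exists>D. ((\<lambda>z. G z + F z) has_real_derivative D) (at z) \<and> D \<le> 0"
      using dF dG FG[of z] by (intro exI[of _ "G' z + F' z"]) (auto intro!: derivative_eq_intros)
  qed
  ultimately have "\<bar>F y\<bar> \<le> G y" using F0 G0 by simp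
  moreover have "\<bar>cos (M * y / 2) / (M * sin (y / 2))\<bar> \<le> 1 / (M * sin (y / 2))"
    using M sp[of y] y by (simp add: divide_right_mono abs_mult)
  moreover have "G y \<le> 1 / (M * sin (y / 2))"
    using M sp[of y] y unfolding G_def by (simp add: divide_right_mono)
  ultimately have "\<bar>saw_sum N y - (pi - y) / 2\<bar> \<le> 1 / (M * sin (y / 2)) + 1 / (M * sin (y / 2))"
    unfolding F_def by linarith
  thus ?thesis by (simp add: M_def mult.commute)
qed

text \<open>The reflection of y to 2 pi - y changes the sign of the error, by oddness and
  periodicity, and preserves sin (y/2). This reduces the claim to y \<le> pi.\<close>

lemma saw_sum_error:
  assumes y: "0 < y" "y < 2 * pi"
  shows "\<bar>saw_sum N y - (pi - y) / 2\<bar> \<le> 2 / ((2 * real N + 1) * sin (y / 2))"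
proof (cases "y \<le> pi")
  case False
  have "saw_sum N (2 * pi - y) = - saw_sum N y"
    using saw_sum_periodic[of N "- y" 1] by (simp add: saw_sum_minus)
  moreover have "sin ((2 * pi - y) / 2) = sin (y / 2)"
    by (simp add: diff_divide_distrib)
  moreover have "- saw_sum N y - (pi - (2 * pi - y)) / 2 = - (saw_sum N y - (pi - y) / 2)"
    by (simp add: field_simps)
  ultimately show ?thesis
    using saw_sum_error_half[of "2 * pi - y" N] False y by (simp only: abs_minus_cancel)
qed (use y saw_sum_error_half in auto)

text \<open>On [0, pi] the cases are separated at N y = 1. Below it, each of the N terms is at most
  y, so the sum is at most 1. Above it, the limit (pi - y) / 2 is at most pi / 2 and the error at
  most 4. Periodicity and oddness then cover all y.\<close>

lemma saw_sum_bounded: "\<bar>saw_sum N y\<bar> \<le> 10"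
proof -
  have half: "\<bar>saw_sum N y\<bar> \<le> 10" if y: "0 \<le> y" "y \<le> pi" for y
  proof (cases "real N * y \<le> 1")
    case True
    have "\<bar>saw_sum N y\<bar> \<le> (\<Sum>m<N. \<bar>sin (real (Suc m) * y) / real (Suc m)\<bar>)"
      unfolding saw_sum_def by (rule sum_abs)
    also have "\<dots> \<le> (\<Sum>m<N. y)"
    proof (rule sum_mono)
      fix m
      have "\<bar>sin (real (Suc m) * y)\<bar> \<le> \<bar>real (Suc m) * y\<bar>" by (rule abs_sin_x_le_abs_x)
      thus "\<bar>sin (real (Suc m) * y) / real (Suc m)\<bar> \<le> y"
        using y by (simp add: abs_mult field_simps)
    qed
    finally show ?thesis using True by simp
  next
    case False
    hence N: "real N * y > 1" by simp
    hence y0: "y > 0" using y by (cases "y = 0") auto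
    have s: "sin (y / 2) \<ge> y / 4" using sin_ge_half[of "y/2"] y by simp
    have "(2 * real N + 1) * sin (y / 2) \<ge> (2 * real N + 1) * (y / 4)"
      using s by (intro mult_left_mono) auto
    also have "(2 * real N + 1) * (y / 4) \<ge> 1/2" using N y0 by (simp add: field_simps)
    finally have "2 / ((2 * real N + 1) * sin (y / 2)) \<le> 2 / (1/2)"
      by (intro divide_left_mono) auto
    hence "\<bar>saw_sum N y - (pi - y) / 2\<bar> \<le> 4"
      using saw_sum_error_half[OF y0 y(2), of N] by simp
    thus ?thesis using y pi_less_4 by (simp add: field_simps abs_le_iff)
  qed
  define r where "r = y - 2 * pi * of_int \<lfloor>y / (2 * pi)\<rfloor>"
  have r: "0 \<le> r" "r < 2 * pi"
    using floor_divide_lower[of "2 * pi" y] floor_divide_upper[of "2 * pi" y]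
    by (simp_all add: r_def field_simps)
  have e: "saw_sum N y = saw_sum N r"
    using saw_sum_periodic[of N r "\<lfloor>y / (2 * pi)\<rfloor>"] by (simp add: r_def)
  show ?thesis
  proof (cases "r \<le> pi")
    case False
    have "saw_sum N (2 * pi - r) = - saw_sum N r"
      using saw_sum_periodic[of N "- r" 1] by (simp add: saw_sum_minus)
    thus ?thesis using half[of "2 * pi - r"] False r e by simp
  qed (use half r e in auto)
qed

text \<open>The right-continuous 2 pi periodic sawtooth, equal to (pi - y) / 2 on [0, 2 pi). At the
  jumps its value is pi / 2 while the sine series sums to 0, hence the condition sin (y/2) \<noteq>
  0 in the convergence statements.\<close>

definition saw :: "real \<Rightarrow> real" where
  "saw y = (pi - y) / 2 + pi * of_int \<lfloor>y / (2 * pi)\<rfloor>"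

lemma saw_sum_tendsto_saw:
  assumes "sin (y / 2) \<noteq> 0"
  shows "(\<lambda>N. saw_sum N y) \<longlonglongrightarrow> saw y"
proof -
  define k where "k = \<lfloor>y / (2 * pi)\<rfloor>"
  define r where "r = y - 2 * pi * of_int k"
  have r: "0 \<le> r" "r < 2 * pi"
    using floor_divide_lower[of "2 * pi" y] floor_divide_upper[of "2 * pi" y]
    by (simp_all add: r_def k_def field_simps)
  have "r \<noteq> 0"
  proof
    assume "r = 0"
    hence "y / 2 = pi * of_int k" by (simp add: r_def)
    thus False using assms by (simp add: sin_zero_iff_int2 mult.commute) 
  qed
  hence r0: "r > 0" using r by simp
  have "(\<lambda>N. 2 / ((2 * real N + 1) * sin (r / 2))) \<longlonglongrightarrow> 0"
  proof -
    have "(\<lambda>N. 1 / (2 * real N + 1)) \<longlonglongrightarrow> 0" by real_asymp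
    hence "(\<lambda>N. 2 / sin (r / 2) * (1 / (2 * real N + 1))) \<longlonglongrightarrow> 2 / sin (r / 2) * 0"
      by (intro tendsto_intros)
    thus ?thesis by (simp add: mult.commute)
  qed
  hence "(\<lambda>N. saw_sum N r - (pi - r) / 2) \<longlonglongrightarrow> 0"
    by (rule Lim_null_comparison[rotated]) (use saw_sum_error[OF r0 r(2)] in auto)
  hence "(\<lambda>N. saw_sum N r) \<longlonglongrightarrow> (pi - r) / 2" by (simp add: LIM_zero_iff)
  moreover have "saw_sum N y = saw_sum N r" for N
    using saw_sum_periodic[of N r k] by (simp add: r_def)
  moreover have "(pi - r) / 2 = saw y" by (simp add: saw_def r_def k_def field_simps)
  ultimately show ?thesis by simp
qed

section \<open>Perturbed frequencies\<close>

lemma abs_sin_diff_le: "\<bar>sin v - sin u\<bar> \<le> \<bar>v - u\<bar>" for u v :: real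
proof -
  have "norm (sin v - sin u) \<le> 1 * norm (v - u)"
    by (rule field_differentiable_bound[where S = UNIV and f' = cos])
       (auto intro!: derivative_eq_intros)
  thus ?thesis by simp
qed

text \<open>As a function of the increment x, the expression has derivative sin a - sin (a + x),
  which is at most \<bar>e\<bar> in absolute value for x between - \<bar>e\<bar> and
  \<bar>e\<bar>.\<close>

lemma abs_cos_add_taylor: "\<bar>cos (a + e) - cos a + e * sin a\<bar> \<le> (e::real)\<^sup>2"
proof -
  let ?f = "\<lambda>x. cos (a + x) + x * sin a"
  have "norm (?f e - ?f 0) \<le> \<bar>e\<bar> * norm (e - 0)"
  proof (rule field_differentiable_bound)
    show "convex {- \<bar>e\<bar>..\<bar>e\<bar>}" by simp
    fix x assume x: "x \<in> {- \<bar>e\<bar>..\<bar>e\<bar>}"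
    show "(?f has_field_derivative (- sin (a + x) + sin a)) (at x within {- \<bar>e\<bar>..\<bar>e\<bar>})"
      by (auto intro!: derivative_eq_intros)
    show "norm (- sin (a + x) + sin a) \<le> \<bar>e\<bar>" using abs_sin_diff_le[of "a + x" a] x by auto
  qed auto
  thus ?thesis by (simp add: power2_eq_square algebra_simps abs_mult_self_eq)
qed

lemma sum_inverse_squares_le: "(\<Sum>m<N. 1 / (real (m + 2))\<^sup>2) \<le> 1"
proof -
  \<comment> \<open>The sharper bound lets the induction close by telescoping: 1 / (N+2)^2 is at
    most 1 / (N+1) - 1 / (N+2).\<close>
  have "(\<Sum>m<N. 1 / (real (m + 2))\<^sup>2) \<le> 1 - 1 / real (N + 1)"
  proof (induction N)
    case (Suc N)
    have "1 / (real (N + 2))\<^sup>2 \<le> 1 / (real (N + 1) * real (N + 2))"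
      unfolding power2_eq_square by (intro divide_left_mono mult_right_mono) auto
    also have "\<dots> = 1 / real (N + 1) - 1 / real (N + 2)"
      by (simp add: field_simps)
    finally have "1 / (real (N + 2))\<^sup>2 \<le> 1 / real (N + 1) - 1 / real (N + 2)" .
    thus ?case using Suc by simp
  qed auto
  thus ?thesis by (smt (verit) divide_nonneg_nonneg of_nat_0_le_iff)
qed

definition freq_sum :: "(nat \<Rightarrow> real) \<Rightarrow> nat \<Rightarrow> real \<Rightarrow> real" where
  "freq_sum \<omega> N y = (\<Sum>m<N. sin (\<omega> (m + 2) * y) / \<omega> (m + 2))"

lemma saw_sum_Suc_eq: "(\<Sum>m<N. sin (real (m + 2) * y) / real (m + 2)) = saw_sum (Suc N) y - sin y"
  unfolding saw_sum_def by (subst sum.lessThan_Suc_shift) (simp add: algebra_simps)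

text \<open>The expansion goes to second order because an error O(1/n) in the differentiated series
  would not be summable. The term c / n has to be known exactly, so that its contribution can be
  recognised as a multiple of the sawtooth series.\<close>

locale asymptotic_frequencies =
  fixes \<omega> :: "nat \<Rightarrow> real" and c C :: real
  assumes ge_one: "\<And>n. n \<ge> 2 \<Longrightarrow> \<omega> n \<ge> 1"
    and asymp: "\<And>n. n \<ge> 2 \<Longrightarrow> \<bar>\<omega> n - real n - c / real n\<bar> \<le> C / (real n)\<^sup>2"
begin

definition diff_term :: "nat \<Rightarrow> real \<Rightarrow> real" where
  "diff_term m y = sin (\<omega> (m + 2) * y) / \<omega> (m + 2) - sin (real (m + 2) * y) / real (m + 2)"

definition diff_sum :: "real \<Rightarrow> real" where
  "diff_sum y = (\<Sum>m. diff_term m y)"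

lemma C_nonneg: "C \<ge> 0"
proof -
  have "0 \<le> C / (real 2)\<^sup>2" by (rule order_trans[OF abs_ge_zero asymp]) simp
  thus ?thesis by simp
qed

lemma shift_le:
  assumes "n \<ge> 2" shows "\<bar>\<omega> n - real n\<bar> \<le> (\<bar>c\<bar> + C) / real n"
proof -
  have "C / (real n)\<^sup>2 \<le> C / real n"
    using assms C_nonneg by (intro divide_left_mono) (auto simp: power2_eq_square)
  moreover have "\<bar>c / real n\<bar> = \<bar>c\<bar> / real n" using assms by simp
  ultimately show ?thesis using asymp[OF assms] unfolding add_divide_distrib by linarith
qed

text \<open>Exchanging the denominator and exchanging the argument of the sine are estimated
  separately. Each costs the frequency shift O(1/n) times a further factor O(1/n).\<close>

lemma diff_term_le: "\<bar>diff_term m y\<bar> \<le> (\<bar>c\<bar> + C) * (1 + \<bar>y\<bar>) * (1 / (real (m + 2))\<^sup>2)"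
proof -
  define n where "n = real (m + 2)"
  define l where "l = \<omega> (m + 2)"
  define D where "D = \<bar>c\<bar> + C"
  have n: "n \<ge> 2" and l: "l \<ge> 1" using ge_one[of "m + 2"] by (auto simp: n_def l_def)
  have d: "\<bar>l - n\<bar> \<le> D / n" using shift_le[of "m + 2"] by (simp add: n_def l_def D_def)
  have D: "D \<ge> 0" using C_nonneg by (simp add: D_def)
  have s: "\<bar>sin (l * y) - sin (n * y)\<bar> \<le> \<bar>l * y - n * y\<bar>" by (rule abs_sin_diff_le)
  have "\<bar>sin (l * y) * (1 / l - 1 / n)\<bar> \<le> D / n\<^sup>2"
  proof -
    have e: "1 / l - 1 / n = (n - l) / (l * n)" using n l by (simp add: field_simps)
    have "\<bar>sin (l * y) * (1 / l - 1 / n)\<bar> \<le> 1 * \<bar>1 / l - 1 / n\<bar>"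
      unfolding abs_mult by (intro mult_right_mono) auto
    also have "\<dots> = \<bar>l - n\<bar> / (l * n)"
      unfolding e using n l by (simp add: abs_mult abs_minus_commute)
    also have "\<dots> \<le> (D / n) / (1 * n)"
      using n l d D by (intro frac_le mult_right_mono) auto
    finally show ?thesis by (simp only: power2_eq_square divide_divide_eq_left mult_1)
  qed
  moreover have "\<bar>(sin (l * y) - sin (n * y)) / n\<bar> \<le> D * \<bar>y\<bar> / n\<^sup>2"
  proof -
    have "\<bar>sin (l * y) - sin (n * y)\<bar> \<le> \<bar>l - n\<bar> * \<bar>y\<bar>"
      using s by (simp add: abs_mult[symmetric] algebra_simps)
    also have "\<dots> \<le> D / n * \<bar>y\<bar>" using d by (intro mult_right_mono) auto
    finally have "\<bar>sin (l * y) - sin (n * y)\<bar> / n \<le> D / n * \<bar>y\<bar> / n"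
      using n by (intro divide_right_mono) auto
    thus ?thesis using n by (simp add: power2_eq_square)
  qed
  moreover have "diff_term m y = sin (l * y) * (1 / l - 1 / n) + (sin (l * y) - sin (n * y)) / n"
    by (simp add: diff_term_def l_def n_def algebra_simps diff_divide_distrib)
  ultimately have "\<bar>diff_term m y\<bar> \<le> D / n\<^sup>2 + D * \<bar>y\<bar> / n\<^sup>2" by linarith
  thus ?thesis by (simp add: D_def n_def algebra_simps add_divide_distrib)
qed

lemma summable_diff_term: "summable (\<lambda>m. diff_term m y)"
proof (rule summable_comparison_test')
  have "summable (\<lambda>m. 1 / (real m)\<^sup>2)"
    using inverse_power_summable[of 2, where 'a = real] by (simp add: inverse_eq_divide)
  hence "summable (\<lambda>m. 1 / (real (m + 2))\<^sup>2)" by (subst summable_iff_shift)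
  thus "summable (\<lambda>m. (\<bar>c\<bar> + C) * (1 + \<bar>y\<bar>) * (1 / (real (m + 2))\<^sup>2))" by (rule summable_mult)
qed (use diff_term_le in auto)

lemma diff_sum_measurable: "diff_sum \<in> borel_measurable borel"
  unfolding diff_sum_def [abs_def] diff_term_def by measurable

lemma sum_diff_term_le: "\<bar>\<Sum>m<N. diff_term m y\<bar> \<le> (\<bar>c\<bar> + C) * (1 + \<bar>y\<bar>)"
proof -
  have "\<bar>\<Sum>m<N. diff_term m y\<bar> \<le> (\<Sum>m<N. (\<bar>c\<bar> + C) * (1 + \<bar>y\<bar>) * (1 / (real (m + 2))\<^sup>2))"
    using diff_term_le by (intro order_trans[OF sum_abs] sum_mono)
  also have "\<dots> = (\<bar>c\<bar> + C) * (1 + \<bar>y\<bar>) * (\<Sum>m<N. 1 / (real (m + 2))\<^sup>2)"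
    by (rule sum_distrib_left [symmetric])
  also have "\<dots> \<le> (\<bar>c\<bar> + C) * (1 + \<bar>y\<bar>) * 1"
    using C_nonneg sum_inverse_squares_le by (intro mult_left_mono) auto
  finally show ?thesis by simp
qed

text \<open>The summands are \<open>- c y sin (n y) / n + O(1 / n\<^sup>2)\<close>, so the partial sums inherit
  boundedness from the partial sums of the sawtooth series.\<close>

lemma sum_cos_diff_le:
  "\<bar>\<Sum>m<N. cos (\<omega> (m + 2) * y) - cos (real (m + 2) * y)\<bar> \<le>
     11 * \<bar>c\<bar> * \<bar>y\<bar> + ((\<bar>c\<bar> + C)\<^sup>2 * \<bar>y\<bar>\<^sup>2 + C * \<bar>y\<bar>)"
proof -
  define D where "D = \<bar>c\<bar> + C"
  define r where "r = (\<lambda>m. cos (\<omega> (m + 2) * y) - cos (real (m + 2) * y)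
    + c * y * (sin (real (m + 2) * y) / real (m + 2)))"
  have r: "\<bar>r m\<bar> \<le> (D\<^sup>2 * \<bar>y\<bar>\<^sup>2 + C * \<bar>y\<bar>) * (1 / (real (m + 2))\<^sup>2)" for m
  proof -
    define n where "n = real (m + 2)"
    define d where "d = \<omega> (m + 2) - n"
    have d: "\<bar>d\<bar> \<le> D / n" "\<bar>d - c / n\<bar> \<le> C / n\<^sup>2"
      using shift_le[of "m + 2"] asymp[of "m + 2"] by (auto simp: n_def d_def D_def)
    have "\<bar>cos (n * y + d * y) - cos (n * y) + d * y * sin (n * y)\<bar> \<le> (d * y)\<^sup>2"
      by (rule abs_cos_add_taylor)
    also have "(d * y)\<^sup>2 = \<bar>d\<bar>\<^sup>2 * \<bar>y\<bar>\<^sup>2" by (simp add: power_mult_distrib)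
    also have "\<dots> \<le> (D / n)\<^sup>2 * \<bar>y\<bar>\<^sup>2" using d by (intro mult_right_mono power_mono) auto
    finally have 1: "\<bar>cos (n * y + d * y) - cos (n * y) + d * y * sin (n * y)\<bar> \<le> (D / n)\<^sup>2 * \<bar>y\<bar>\<^sup>2" .
    have 2: "\<bar>(d - c / n) * y * sin (n * y)\<bar> \<le> C / n\<^sup>2 * \<bar>y\<bar> * 1"
      unfolding abs_mult using d(2) C_nonneg by (intro mult_mono) auto
    \<comment> \<open>The first bracket is the Taylor remainder at n y with increment d y. The
      second term is the cost of replacing the shift d by its leading part c / n.\<close>
    have "r m = (cos (n * y + d * y) - cos (n * y) + d * y * sin (n * y)) - (d - c / n) * y * sin (n * y)"
      by (simp add: r_def n_def d_def algebra_simps)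
    hence "\<bar>r m\<bar> \<le> (D / n)\<^sup>2 * \<bar>y\<bar>\<^sup>2 + C / n\<^sup>2 * \<bar>y\<bar> * 1"
      using order_trans[OF abs_triangle_ineq4 add_mono[OF 1 2]] by (simp only:)
    hence "\<bar>r m\<bar> \<le> (D / n)\<^sup>2 * \<bar>y\<bar>\<^sup>2 + C / n\<^sup>2 * \<bar>y\<bar>" by simp
    also have "\<dots> = (D\<^sup>2 * \<bar>y\<bar>\<^sup>2 + C * \<bar>y\<bar>) * (1 / n\<^sup>2)"
      by (simp add: power_divide algebra_simps add_divide_distrib)
    finally show ?thesis by (simp add: n_def)
  qed
  have "\<bar>\<Sum>m<N. r m\<bar> \<le> (\<Sum>m<N. (D\<^sup>2 * \<bar>y\<bar>\<^sup>2 + C * \<bar>y\<bar>) * (1 / (real (m + 2))\<^sup>2))"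
    using r by (intro order_trans[OF sum_abs] sum_mono)
  also have "\<dots> = (D\<^sup>2 * \<bar>y\<bar>\<^sup>2 + C * \<bar>y\<bar>) * (\<Sum>m<N. 1 / (real (m + 2))\<^sup>2)"
    by (rule sum_distrib_left [symmetric])
  also have "\<dots> \<le> (D\<^sup>2 * \<bar>y\<bar>\<^sup>2 + C * \<bar>y\<bar>) * 1"
    using C_nonneg sum_inverse_squares_le by (intro mult_left_mono) auto
  finally have 1: "\<bar>\<Sum>m<N. r m\<bar> \<le> D\<^sup>2 * \<bar>y\<bar>\<^sup>2 + C * \<bar>y\<bar>" by simp
  \<comment> \<open>The bound is 10 for the sawtooth sum and 1 for its term n = 1, which the series
    starting at n = 2 lacks.\<close>
  have "\<bar>saw_sum (Suc N) y - sin y\<bar> \<le> 11"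
    using saw_sum_bounded[of "Suc N" y] abs_sin_le_one[of y] by linarith
  hence "\<bar>c * y\<bar> * \<bar>saw_sum (Suc N) y - sin y\<bar> \<le> \<bar>c * y\<bar> * 11" by (intro mult_left_mono) auto
  hence 2: "\<bar>c * y * (saw_sum (Suc N) y - sin y)\<bar> \<le> 11 * \<bar>c\<bar> * \<bar>y\<bar>" by (simp add: abs_mult)
  have "(\<Sum>m<N. r m) = (\<Sum>m<N. cos (\<omega> (m + 2) * y) - cos (real (m + 2) * y)) +
      c * y * (saw_sum (Suc N) y - sin y)"
    unfolding saw_sum_Suc_eq[symmetric] sum_distrib_left r_def by (rule sum.distrib)
  thus ?thesis using 1 2 unfolding D_def by linarith
qed

text \<open>The differentiated partial sums are bounded uniformly in \<open>N\<close> on [-R, R], so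
  all partial sums share one Lipschitz constant, and it survives the pointwise limit.\<close>

lemma diff_sum_lipschitz:
  assumes u: "\<bar>u\<bar> \<le> R" and v: "\<bar>v\<bar> \<le> R"
  shows "\<bar>diff_sum v - diff_sum u\<bar> \<le> (11 * \<bar>c\<bar> * R + ((\<bar>c\<bar> + C)\<^sup>2 * R\<^sup>2 + C * R)) * \<bar>v - u\<bar>"
proof (rule LIMSEQ_le_const2)
  have "(\<lambda>N. \<Sum>m<N. diff_term m y) \<longlonglongrightarrow> diff_sum y" for y
    unfolding diff_sum_def by (rule summable_LIMSEQ[OF summable_diff_term])
  thus "(\<lambda>N. \<bar>(\<Sum>m<N. diff_term m v) - (\<Sum>m<N. diff_term m u)\<bar>) \<longlonglongrightarrow> \<bar>diff_sum v - diff_sum u\<bar>"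
    by (intro tendsto_intros)
  have "\<bar>(\<Sum>m<N. diff_term m v) - (\<Sum>m<N. diff_term m u)\<bar> \<le>
    (11 * \<bar>c\<bar> * R + ((\<bar>c\<bar> + C)\<^sup>2 * R\<^sup>2 + C * R)) * \<bar>v - u\<bar>" for N
    unfolding real_norm_def[symmetric]
  proof (rule field_differentiable_bound)
    show "convex {-R..R}" by simp
    show "v \<in> {-R..R}" "u \<in> {-R..R}" using u v by auto
    fix y assume y: "y \<in> {-R..R}"
    have "\<omega> (m + 2) \<noteq> 0" for m using ge_one[of "m + 2"] by auto
    thus "((\<lambda>y. \<Sum>m<N. diff_term m y) has_field_derivative
       (\<Sum>m<N. cos (\<omega> (m + 2) * y) - cos (real (m + 2) * y))) (at y within {-R..R})"
      unfolding diff_term_def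
      by (auto intro!: derivative_eq_intros sum.cong simp del: of_nat_add)
    have "11 * \<bar>c\<bar> * \<bar>y\<bar> + ((\<bar>c\<bar> + C)\<^sup>2 * \<bar>y\<bar>\<^sup>2 + C * \<bar>y\<bar>) \<le>
        11 * \<bar>c\<bar> * R + ((\<bar>c\<bar> + C)\<^sup>2 * R\<^sup>2 + C * R)"
      using y C_nonneg by (intro add_mono mult_left_mono power_mono) auto
    thus "norm (\<Sum>m<N. cos (\<omega> (m + 2) * y) - cos (real (m + 2) * y)) \<le>
        11 * norm c * R + ((norm c + C)\<^sup>2 * R\<^sup>2 + C * R)"
      using sum_cos_diff_le[of y N] by simp
  qed
  thus "\<exists>N. \<forall>n\<ge>N. \<bar>(\<Sum>m<n. diff_term m v) - (\<Sum>m<n. diff_term m u)\<bar> \<le>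
    (11 * \<bar>c\<bar> * R + ((\<bar>c\<bar> + C)\<^sup>2 * R\<^sup>2 + C * R)) * \<bar>v - u\<bar>" by blast
qed

lemma freq_sum_eq: "freq_sum \<omega> N y = saw_sum (Suc N) y - sin y + (\<Sum>m<N. diff_term m y)"
  by (simp add: freq_sum_def diff_term_def saw_sum_Suc_eq[symmetric] sum_subtractf)

lemma freq_sum_le: "\<bar>freq_sum \<omega> N y\<bar> \<le> 11 + (\<bar>c\<bar> + C) * (1 + \<bar>y\<bar>)"
  using saw_sum_bounded[of "Suc N" y] abs_sin_le_one[of y] sum_diff_term_le[of y N]
  unfolding freq_sum_eq by linarith

lemma freq_sum_tendsto:
  assumes "sin (y / 2) \<noteq> 0"
  shows "(\<lambda>N. freq_sum \<omega> N y) \<longlonglongrightarrow> saw y + (diff_sum y - sin y)"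
proof -
  have "(\<lambda>N. saw_sum (Suc N) y - sin y + (\<Sum>m<N. diff_term m y)) \<longlonglongrightarrow> saw y - sin y + diff_sum y"
    unfolding diff_sum_def
    by (intro tendsto_intros LIMSEQ_Suc saw_sum_tendsto_saw assms summable_LIMSEQ summable_diff_term)
  thus ?thesis by (simp add: freq_sum_eq algebra_simps)
qed

end

section \<open>Absolute continuity of the kernel integrals\<close>

text \<open>Absolute continuity is phrased for interval functions \<open>w u v\<close> that majorise \<open>\<bar>f v - f u\<bar>\<close>,
  because majorants of different origin can then be added.\<close>

definition small_variation :: "(real \<Rightarrow> real \<Rightarrow> real) \<Rightarrow> real \<Rightarrow> real \<Rightarrow> bool" where
  "small_variation w \<epsilon> \<eta> \<longleftrightarrow>
     (\<forall>(N::nat) u v.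
        (\<forall>i<N. u i \<le> v i) \<longrightarrow>
        disjoint_family_on (\<lambda>i. {u i<..<v i}) {..<N} \<longrightarrow>
        (\<Sum>i<N. v i - u i) < \<eta> \<longrightarrow>
        (\<Sum>i<N. w (u i) (v i)) < \<epsilon>)"

definition abs_continuous_interval_fun :: "(real \<Rightarrow> real \<Rightarrow> real) \<Rightarrow> bool" where
  "abs_continuous_interval_fun w \<longleftrightarrow> (\<forall>\<epsilon>>0. \<exists>\<eta>>0. small_variation w \<epsilon> \<eta>)"

lemma small_variationI:
  assumes "\<And>(N::nat) u v. (\<And>i. i < N \<Longrightarrow> u i \<le> v i) \<Longrightarrow>
      disjoint_family_on (\<lambda>i. {u i<..<v i}) {..<N} \<Longrightarrow>
      (\<Sum>i<N. v i - u i) < \<eta> \<Longrightarrow> (\<Sum>i<N. w (u i) (v i)) < \<epsilon>"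
  shows "small_variation w \<epsilon> \<eta>"
  using assms unfolding small_variation_def by simp

lemma small_variationD:
  fixes N :: nat
  assumes "small_variation w \<epsilon> \<eta>" "\<And>i. i < N \<Longrightarrow> u i \<le> v i"
    "disjoint_family_on (\<lambda>i. {u i<..<v i}) {..<N}" "(\<Sum>i<N. v i - u i) < \<eta>"
  shows "(\<Sum>i<N. w (u i) (v i)) < \<epsilon>"
  using assms unfolding small_variation_def by blast

lemma abs_continuous_interval_funI:
  assumes "\<And>\<epsilon>. \<epsilon> > 0 \<Longrightarrow> \<exists>\<eta>>0. small_variation w \<epsilon> \<eta>"
  shows "abs_continuous_interval_fun w"
  using assms unfolding abs_continuous_interval_fun_def by simp

lemma abs_continuous_interval_funE:
  assumes "abs_continuous_interval_fun w" "\<epsilon> > 0"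
  obtains \<eta> where "\<eta> > 0" "small_variation w \<epsilon> \<eta>"
  using assms unfolding abs_continuous_interval_fun_def by blast

lemma abs_continuous_interval_fun_add:
  assumes w: "abs_continuous_interval_fun w" and w': "abs_continuous_interval_fun w'"
  shows "abs_continuous_interval_fun (\<lambda>u v. w u v + w' u v)"
proof (rule abs_continuous_interval_funI)
  fix \<epsilon> :: real assume "\<epsilon> > 0"
  then have e: "\<epsilon> / 2 > 0" by simp
  obtain \<eta>1 where 1: "\<eta>1 > 0" "small_variation w (\<epsilon> / 2) \<eta>1"
    by (rule abs_continuous_interval_funE[OF w e])
  obtain \<eta>2 where 2: "\<eta>2 > 0" "small_variation w' (\<epsilon> / 2) \<eta>2"
    by (rule abs_continuous_interval_funE[OF w' e])
  have "small_variation (\<lambda>u v. w u v + w' u v) \<epsilon> (min \<eta>1 \<eta>2)"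
  proof (rule small_variationI)
    fix N :: nat and u v :: "nat \<Rightarrow> real"
    assume uv: "\<And>i. i < N \<Longrightarrow> u i \<le> v i" "disjoint_family_on (\<lambda>i. {u i<..<v i}) {..<N}"
      "(\<Sum>i<N. v i - u i) < min \<eta>1 \<eta>2"
    have "(\<Sum>i<N. w (u i) (v i)) < \<epsilon> / 2" "(\<Sum>i<N. w' (u i) (v i)) < \<epsilon> / 2"
      using uv(3) by (simp_all only: small_variationD[OF 1(2) uv(1,2)] small_variationD[OF 2(2) uv(1,2)] min_less_iff_conj)
    thus "(\<Sum>i<N. w (u i) (v i) + w' (u i) (v i)) < \<epsilon>" by (simp add: sum.distrib)
  qed
  thus "\<exists>\<eta>>0. small_variation (\<lambda>u v. w u v + w' u v) \<epsilon> \<eta>"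
    using 1(1) 2(1) by (intro exI[of _ "min \<eta>1 \<eta>2"]) simp
qed

lemma abs_continuous_interval_fun_linear:
  assumes "K \<ge> 0"
  shows "abs_continuous_interval_fun (\<lambda>u v. K * (v - u))"
proof (rule abs_continuous_interval_funI)
  fix \<epsilon> :: real assume e: "\<epsilon> > 0"
  \<comment> \<open>The denominator \<open>K + 1\<close> stays positive for
    \<open>K = 0\<close>.\<close>
  have "small_variation (\<lambda>u v. K * (v - u)) \<epsilon> (\<epsilon> / (K + 1))"
  proof (rule small_variationI)
    fix N :: nat and u v :: "nat \<Rightarrow> real"
    assume le: "\<And>i. i < N \<Longrightarrow> u i \<le> v i" and s: "(\<Sum>i<N. v i - u i) < \<epsilon> / (K + 1)"
    have "(\<Sum>i<N. v i - u i) \<ge> 0" using le by (intro sum_nonneg) auto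
    hence "K * (\<Sum>i<N. v i - u i) \<le> (K + 1) * (\<Sum>i<N. v i - u i)" by (intro mult_right_mono) auto
    also have "\<dots> < \<epsilon>" using s assms by (simp add: field_simps)
    finally show "(\<Sum>i<N. K * (v i - u i)) < \<epsilon>" by (simp add: sum_distrib_left)
  qed
  thus "\<exists>\<eta>>0. small_variation (\<lambda>u v. K * (v - u)) \<epsilon> \<eta>"
    using e assms by (intro exI[of _ "\<epsilon> / (K + 1)"]) simp
qed

section \<open>Absolute continuity of the Lebesgue integral, by truncation\<close>

lemma tail_integral_tendsto_0:
  fixes g :: "'a \<Rightarrow> real"
  assumes "integrable M g"
  shows "(\<lambda>k::nat. \<integral>t. g t * indicator {t. g t > real k} t \<partial>M) \<longlonglongrightarrow> 0"
proof -
  have [measurable]: "g \<in> borel_measurable M" using assms by auto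
  have "(\<lambda>k::nat. \<integral>t. g t * indicator {t. g t > real k} t \<partial>M) \<longlonglongrightarrow> (\<integral>t. 0 \<partial>M)"
  proof (rule integral_dominated_convergence[where w = "\<lambda>t. \<bar>g t\<bar>"])
    show "AE t in M. (\<lambda>k. g t * indicator {t. g t > real k} t) \<longlonglongrightarrow> 0"
    proof (rule AE_I2)
      fix t
      obtain k0 :: nat where "g t \<le> real k0" using real_arch_simple by blast
      hence "\<forall>\<^sub>F k in sequentially. g t * indicator {t. g t > real k} t = 0"
        by (intro eventually_sequentiallyI[of k0]) (auto simp: indicator_def)
      thus "(\<lambda>k. g t * indicator {t. g t > real k} t) \<longlonglongrightarrow> 0" by (rule tendsto_eventually)
    qed
  qed (use assms in \<open>auto simp: indicator_def\<close>)
  thus ?thesis by simp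
qed

text \<open>Truncate \<open>g\<close> at a height \<open>k\<close> whose tail integral is below
  \<epsilon> / 2. The bounded part contributes at most k K times the total length. The tail
  contributes at most its full integral, since disjoint intervals have disjoint preimages. The map
  \<phi> allows endpoints that move in either direction with the parameter.\<close>

lemma abs_continuous_interval_fun_integral:
  fixes g \<phi> :: "'a \<Rightarrow> real"
  assumes g: "integrable M g" "\<And>t. g t \<ge> 0" and K: "K \<ge> 0"
    and \<phi>: "\<And>u v. u \<le> v \<Longrightarrow> {t\<in>space M. u < \<phi> t \<and> \<phi> t < v} \<in> fmeasurable M"
      "\<And>u v. u \<le> v \<Longrightarrow> measure M {t\<in>space M. u < \<phi> t \<and> \<phi> t < v} \<le> K * (v - u)"
  shows "abs_continuous_interval_fun (\<lambda>u v. \<integral>t. g t * indicator {t\<in>space M. u < \<phi> t \<and> \<phi> t < v} t \<partial>M)"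
proof (rule abs_continuous_interval_funI)
  fix \<epsilon> :: real assume e: "\<epsilon> > 0"
  define A where "A = (\<lambda>u v. {t\<in>space M. u < \<phi> t \<and> \<phi> t < v})"
  have [measurable]: "g \<in> borel_measurable M" using g by auto
  obtain k :: nat where k: "(\<integral>t. g t * indicator {t. g t > real k} t \<partial>M) < \<epsilon> / 2"
  proof -
    have "\<forall>\<^sub>F k::nat in sequentially. (\<integral>t. g t * indicator {t. g t > real k} t \<partial>M) < \<epsilon> / 2"
      using e by (intro order_tendstoD(2)[OF tail_integral_tendsto_0[OF g(1)]]) auto
    thus ?thesis using that unfolding eventually_sequentially by blast
  qed
  define G where "G = (\<lambda>t. g t * indicator {t. g t > real k} t)"
  have G: "integrable M G" unfolding G_def
    by (rule Bochner_Integration.integrable_bound[OF g(1)]) (auto simp: indicator_def)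
  have G0: "G t \<ge> 0" for t using g(2)[of t] by (simp add: G_def)
  \<comment> \<open>Pointwise \<open>g\<close> is at most \<open>k + G\<close>: where
    \<open>g\<close> exceeds \<open>k\<close> it equals \<open>G\<close>, and elsewhere it is at
    most \<open>k\<close>.\<close>
  have bound: "(\<integral>t. g t * indicator (A u v) t \<partial>M) \<le> real k * K * (v - u) + (\<integral>t. G t * indicator (A u v) t \<partial>M)"
    if "u \<le> v" for u v
  proof -
    have A: "A u v \<in> fmeasurable M" "measure M (A u v) \<le> K * (v - u)"
      using \<phi> that by (auto simp: A_def)
    hence As: "A u v \<in> sets M" by auto
    have iA: "integrable M (indicator (A u v) :: 'a \<Rightarrow> real)"
      using A by (simp add: fmeasurable_def integrable_indicator_iff)
    have ia: "integrable M (\<lambda>t. real k * indicator (A u v) t)" using iA by simp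
    have ig: "integrable M (\<lambda>t. g t * indicator (A u v) t)" "integrable M (\<lambda>t. G t * indicator (A u v) t)"
      using As g(1) G by (auto intro: integrable_real_mult_indicator)
    have "(\<integral>t. g t * indicator (A u v) t \<partial>M) \<le>
        (\<integral>t. real k * indicator (A u v) t + G t * indicator (A u v) t \<partial>M)"
      using ia ig g(2) by (intro integral_mono Bochner_Integration.integrable_add)
        (auto simp: G_def indicator_def)
    also have "\<dots> = (\<integral>t. real k * indicator (A u v) t \<partial>M) + (\<integral>t. G t * indicator (A u v) t \<partial>M)"
      by (rule Bochner_Integration.integral_add[OF ia ig(2)])
    also have "(\<integral>t. real k * indicator (A u v) t \<partial>M) = real k * measure M (A u v)"
      using As by (simp add: sets.sets_into_space Int_absorb1)
    also have "real k * measure M (A u v) \<le> real k * (K * (v - u))"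
      using A by (intro mult_left_mono) auto
    finally show ?thesis by (simp add: mult.assoc)
  qed
  have tail: "(\<Sum>i<N. \<integral>t. G t * indicator (A (u i) (v i)) t \<partial>M) \<le> (\<integral>t. G t \<partial>M)"
    if le: "\<And>i. i < N \<Longrightarrow> u i \<le> v i" and disj: "disjoint_family_on (\<lambda>i. {u i<..<v i}) {..<N}" for N :: nat and u v
  proof -
    have As: "A (u i) (v i) \<in> sets M" if "i < N" for i
      using \<phi>(1)[of "u i" "v i"] le that by (auto simp: A_def)
    have d: "disjoint_family_on (\<lambda>i. A (u i) (v i)) {..<N}"
      using disj unfolding disjoint_family_on_def A_def by fastforce
    have "(\<Sum>i<N. \<integral>t. G t * indicator (A (u i) (v i)) t \<partial>M) =
        (\<integral>t. (\<Sum>i<N. G t * indicator (A (u i) (v i)) t) \<partial>M)"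
      using As G by (intro Bochner_Integration.integral_sum[symmetric])
        (auto intro: integrable_real_mult_indicator)
    also have "\<dots> \<le> (\<integral>t. G t \<partial>M)"
    proof (rule integral_mono)
      show "integrable M (\<lambda>t. \<Sum>i<N. G t * indicator (A (u i) (v i)) t)"
        using As G by (intro Bochner_Integration.integrable_sum)
          (auto intro: integrable_real_mult_indicator)
      fix t
      have "(\<Sum>i<N. G t * indicator (A (u i) (v i)) t) = G t * indicator (\<Union>i<N. A (u i) (v i)) t"
        using d by (simp add: sum_distrib_left[symmetric] indicator_UN_disjoint)
      also have "\<dots> \<le> G t" using G0[of t] by (auto simp: indicator_def)
      finally show "(\<Sum>i<N. G t * indicator (A (u i) (v i)) t) \<le> G t" .
    qed (fact G)
    finally show ?thesis .
  qed
  have "abs_continuous_interval_fun (\<lambda>u v. real k * K * (v - u))"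
    using K by (intro abs_continuous_interval_fun_linear) simp
  then obtain \<eta> where eta: "\<eta> > 0" "small_variation (\<lambda>u v. real k * K * (v - u)) (\<epsilon> / 2) \<eta>"
    using e by (elim abs_continuous_interval_funE[of _ "\<epsilon> / 2"]) auto
  have "small_variation (\<lambda>u v. \<integral>t. g t * indicator (A u v) t \<partial>M) \<epsilon> \<eta>"
  proof (rule small_variationI)
    fix N :: nat and u v :: "nat \<Rightarrow> real"
    assume le: "\<And>i. i < N \<Longrightarrow> u i \<le> v i" and disj: "disjoint_family_on (\<lambda>i. {u i<..<v i}) {..<N}"
      and s: "(\<Sum>i<N. v i - u i) < \<eta>"
    have "(\<Sum>i<N. \<integral>t. g t * indicator (A (u i) (v i)) t \<partial>M) \<le>
        (\<Sum>i<N. real k * K * (v i - u i) + (\<integral>t. G t * indicator (A (u i) (v i)) t \<partial>M))"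
      using le by (intro sum_mono bound) auto
    also have "\<dots> = (\<Sum>i<N. real k * K * (v i - u i)) + (\<Sum>i<N. \<integral>t. G t * indicator (A (u i) (v i)) t \<partial>M)"
      by (rule sum.distrib)
    also have "\<dots> < \<epsilon> / 2 + \<epsilon> / 2"
      by (rule add_less_le_mono[OF small_variationD[OF eta(2) le disj s]
            order_trans[OF tail[OF le disj] less_imp_le[OF k[folded G_def]]]])
    finally show "(\<Sum>i<N. \<integral>t. g t * indicator (A (u i) (v i)) t \<partial>M) < \<epsilon>" by simp
  qed
  thus "\<exists>\<eta>>0. small_variation (\<lambda>u v. \<integral>t. g t * indicator {t\<in>space M. u < \<phi> t \<and> \<phi> t < v} t \<partial>M) \<epsilon> \<eta>"
    using eta(1) unfolding A_def by blast
qed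

lemma abs_continuous_on_segmentI:
  assumes w: "abs_continuous_interval_fun w"
    and le: "\<And>u v. a \<le> u \<Longrightarrow> u \<le> v \<Longrightarrow> v \<le> b \<Longrightarrow> \<bar>f v - f u\<bar> \<le> w u v"
  shows "abs_continuous_on_segment f a b"
  unfolding abs_continuous_on_segment_def
proof (intro allI impI)
  fix \<epsilon> :: real assume e: "\<epsilon> > 0"
  obtain \<eta> where eta: "\<eta> > 0" "small_variation w \<epsilon> \<eta>"
    by (rule abs_continuous_interval_funE[OF w e])
  show "\<exists>\<eta>>0. \<forall>(N::nat) u v. (\<forall>i<N. a \<le> u i \<and> u i \<le> v i \<and> v i \<le> b) \<longrightarrow>
      disjoint_family_on (\<lambda>i. {u i<..<v i}) {..<N} \<longrightarrow> (\<Sum>i<N. v i - u i) < \<eta> \<longrightarrow>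
      (\<Sum>i<N. \<bar>f (v i) - f (u i)\<bar>) < \<epsilon>"
  proof (intro exI[of _ \<eta>] conjI allI impI)
    fix N :: nat and u v :: "nat \<Rightarrow> real"
    assume uv: "\<forall>i<N. a \<le> u i \<and> u i \<le> v i \<and> v i \<le> b"
      and d: "disjoint_family_on (\<lambda>i. {u i<..<v i}) {..<N}" "(\<Sum>i<N. v i - u i) < \<eta>"
    have "(\<Sum>i<N. \<bar>f (v i) - f (u i)\<bar>) \<le> (\<Sum>i<N. w (u i) (v i))"
      using uv by (intro sum_mono le) auto
    also have "\<dots> < \<epsilon>" using uv d by (intro small_variationD[OF eta(2)]) auto
    finally show "(\<Sum>i<N. \<bar>f (v i) - f (u i)\<bar>) < \<epsilon>" .
  qed (fact eta(1))
qed

text \<open>For these t and x the argument 2 t + x lies in (0, 4 pi) and 2 t - x in (- 2 pi, 2 pi),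
  so each meets at most one interior jump. The linear terms in x cancel, and x survives only in the
  positions of the jumps.\<close>

lemma saw_plus_saw:
  assumes "0 \<le> t" "t \<le> pi" "0 < x" "x < 2 * pi"
  shows "saw (2 * t + x) + saw (2 * t - x) =
     pi - 2 * t + pi * (of_bool (2 * pi - x \<le> 2 * t) - of_bool (2 * t < x))"
proof -
  have "\<lfloor>(2 * t + x) / (2 * pi)\<rfloor> = of_bool (2 * pi - x \<le> 2 * t)"
    using assms by (auto simp: floor_eq_iff field_simps)
  moreover have "\<lfloor>(2 * t - x) / (2 * pi)\<rfloor> = - of_bool (2 * t < x)"
    using assms by (auto simp: floor_eq_iff field_simps)
  ultimately show ?thesis by (simp add: saw_def field_simps)
qed

text \<open>\<open>P\<close> stands for the partial sums of the perturbed sine series and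
  \<open>E\<close> for the Lipschitz rest of its limit, so that both parameter cases are covered.
  The radius 4 pi contains all arguments 2 t + x and 2 t - x. The limit follows by dominated
  convergence. For the variation, \<open>E\<close> changes by at most a multiple of v - u, and the
  jump part only for t between the old and new jump positions.\<close>

lemma
  fixes h E :: "real \<Rightarrow> real" and P :: "nat \<Rightarrow> real \<Rightarrow> real"
  assumes h: "integrable lebesgue h" "\<And>t. t \<notin> {0..pi} \<Longrightarrow> h t = 0"
    and P[measurable]: "\<And>N. P N \<in> borel_measurable borel"
    and P_le: "\<And>N y. \<bar>y\<bar> \<le> 4 * pi \<Longrightarrow> \<bar>P N y\<bar> \<le> B"
    and E[measurable]: "E \<in> borel_measurable borel"
    and lip: "\<And>u v. \<bar>u\<bar> \<le> 4 * pi \<Longrightarrow> \<bar>v\<bar> \<le> 4 * pi \<Longrightarrow> \<bar>E v - E u\<bar> \<le> L * \<bar>v - u\<bar>"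
    and lim: "\<And>y. sin (y / 2) \<noteq> 0 \<Longrightarrow> (\<lambda>N. P N y) \<longlonglongrightarrow> saw y + E y"
  defines "F \<equiv> \<lambda>x. \<integral>t. h t * (saw (2 * t + x) + E (2 * t + x) + (saw (2 * t - x) + E (2 * t - x))) \<partial>lebesgue"
  shows saw_kernel_integral_tendsto: "\<And>x. x \<in> {0<..<2 * pi} \<Longrightarrow> 
      (\<lambda>N. \<integral>t. h t * (P N (2 * t + x) + P N (2 * t - x)) \<partial>lebesgue) \<longlonglongrightarrow> F x"
    and saw_kernel_integral_variation: "\<exists>w. abs_continuous_interval_fun w \<and>
      (\<forall>u v. 0 < u \<longrightarrow> u \<le> v \<longrightarrow> v < 2 * pi \<longrightarrow> \<bar>F v - F u\<bar> \<le> w u v)"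
proof -
  define W where "W = (\<lambda>x t. saw (2 * t + x) + E (2 * t + x) + (saw (2 * t - x) + E (2 * t - x)))"
  have hm[measurable]: "h \<in> borel_measurable lebesgue" using h by auto
  have saw[measurable]: "saw \<in> borel_measurable borel" unfolding saw_def[abs_def] by measurable
  have Wm: "W x \<in> borel_measurable lebesgue" for x
    unfolding W_def by (intro measurable_completion) measurable
  have Pm: "(\<lambda>t. P N (2 * t + x) + P N (2 * t - x)) \<in> borel_measurable lebesgue" for N x
    by (intro measurable_completion) measurable
  have AE_notin: "AE t in lebesgue. t \<notin> S" if "finite S" for S :: "real set"
  proof (rule AE_not_in)
    show "S \<in> null_sets lebesgue"
      using that by (intro null_sets_completionI finite_imp_null_set_lborel)
  qed
  have dct: "AE t in lebesgue. (\<lambda>N. h t * (P N (2 * t + x) + P N (2 * t - x))) \<longlonglongrightarrow> h t * W x t"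
      "AE t in lebesgue. norm (h t * (P N (2 * t + x) + P N (2 * t - x))) \<le> \<bar>h t\<bar> * (2 * B)"
    if x: "0 < x" "x < 2 * pi" for x N
  proof -
    \<comment> \<open>The two exceptional points are those where 2 t + x or 2 t - x hits a jump of
      the sawtooth.\<close>
    have "AE t in lebesgue. t \<notin> {pi - x / 2, x / 2}" by (rule AE_notin) simp
    thus "AE t in lebesgue. (\<lambda>N. h t * (P N (2 * t + x) + P N (2 * t - x))) \<longlonglongrightarrow> h t * W x t"
    proof (rule AE_mp, intro AE_I2 impI)
      fix t assume t: "t \<notin> {pi - x / 2, x / 2}"
      show "(\<lambda>N. h t * (P N (2 * t + x) + P N (2 * t - x))) \<longlonglongrightarrow> h t * W x t"
      proof (cases "t \<in> {0..pi}")
        case True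
        \<comment> \<open>t + x/2 lies in (0, 2 pi) and t - x/2 in (- pi, pi). The only zeros of
          sine there are pi and 0, which the excluded points account for.\<close>
        have "sin ((2 * t + x) / 2) \<noteq> 0"
        proof (cases "t + x / 2 < pi")
          case True
          thus ?thesis using \<open>t \<in> _\<close> x sin_gt_zero[of "t + x / 2"] by (simp add: add_divide_distrib)
        next
          case False
          thus ?thesis using \<open>t \<in> _\<close> x t sin_gt_zero[of "t + x / 2 - pi"] by (simp add: add_divide_distrib)
        qed
        moreover have "sin ((2 * t - x) / 2) \<noteq> 0"
        proof (cases "t > x / 2")
          case True
          thus ?thesis using \<open>t \<in> _\<close> x sin_gt_zero[of "t - x / 2"] by (simp add: diff_divide_distrib)
        next
          case False
          thus ?thesis using \<open>t \<in> _\<close> x t sin_gt_zero[of "x / 2 - t"] sin_minus[of "t - x / 2"]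
            by (simp add: diff_divide_distrib)
        qed
        ultimately show ?thesis unfolding W_def by (intro tendsto_intros lim)
      qed (simp add: h)
    qed
    show "AE t in lebesgue. norm (h t * (P N (2 * t + x) + P N (2 * t - x))) \<le> \<bar>h t\<bar> * (2 * B)"
    proof (rule AE_I2)
      fix t
      show "norm (h t * (P N (2 * t + x) + P N (2 * t - x))) \<le> \<bar>h t\<bar> * (2 * B)"
      proof (cases "t \<in> {0..pi}")
        case True
        have "\<bar>P N (2 * t + x)\<bar> \<le> B" "\<bar>P N (2 * t - x)\<bar> \<le> B"
          using True x by (auto intro!: P_le)
        thus ?thesis unfolding real_norm_def abs_mult by (intro mult_left_mono) auto
      qed (simp add: h)
    qed
  qed
  have ih: "integrable lebesgue (\<lambda>t. \<bar>h t\<bar> * (2 * B))" using h by auto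
  have F: "F x = (\<integral>t. h t * W x t \<partial>lebesgue)" for x by (simp add: F_def W_def)
  show "(\<lambda>N. \<integral>t. h t * (P N (2 * t + x) + P N (2 * t - x)) \<partial>lebesgue) \<longlonglongrightarrow> F x"
    if "x \<in> {0<..<2 * pi}" for x
    unfolding F using that by (intro integral_dominated_convergence[OF _ _ ih dct] borel_measurable_times hm Wm Pm) auto
  have iW: "integrable lebesgue (\<lambda>t. h t * W x t)" if "0 < x" "x < 2 * pi" for x
    using that by (intro integrable_dominated_convergence[OF _ _ ih dct] borel_measurable_times hm Wm Pm) auto

  define A1 where "A1 = (\<lambda>u v. {t::real. u < 2 * t \<and> 2 * t < v})"
  define A2 where "A2 = (\<lambda>u v. {t::real. u < 2 * pi - 2 * t \<and> 2 * pi - 2 * t < v})"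
  \<comment> \<open>The factor pi is the height of a jump of \<open>saw\<close>.\<close>
  define g where "g = (\<lambda>t. pi * \<bar>h t\<bar>)"
  define H where "H = (\<integral>t. \<bar>h t\<bar> \<partial>lebesgue)"
  have L: "L \<ge> 0" using lip[of 0 1] pi_gt3 by simp
  have A1: "A1 u v = {u / 2<..<v / 2}" and A2: "A2 u v = {pi - v / 2<..<pi - u / 2}" for u v
    by (auto simp: A1_def A2_def field_simps)
  have ig: "integrable lebesgue g" and g0: "g t \<ge> 0" for t
    using h by (auto simp: g_def)
  define w where "w = (\<lambda>u v. 2 * L * H * (v - u) + (\<integral>t. g t * indicator (A1 u v) t \<partial>lebesgue) +
     (\<integral>t. g t * indicator (A2 u v) t \<partial>lebesgue))"
  \<comment> \<open>Both preimages are intervals of length (v - u) / 2, so the constant 1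
    suffices.\<close>
  have "abs_continuous_interval_fun (\<lambda>u v. \<integral>t. g t * indicator (A1 u v) t \<partial>lebesgue)"
    using abs_continuous_interval_fun_integral[OF ig g0, of 1 "\<lambda>t. 2 * t"]
    by (simp add: A1[unfolded A1_def] A1)
  moreover have "abs_continuous_interval_fun (\<lambda>u v. \<integral>t. g t * indicator (A2 u v) t \<partial>lebesgue)"
    using abs_continuous_interval_fun_integral[OF ig g0, of 1 "\<lambda>t. 2 * pi - 2 * t"]
    by (simp add: A2[unfolded A2_def] A2)
  moreover have "abs_continuous_interval_fun (\<lambda>u v. 2 * L * H * (v - u))"
    using L by (intro abs_continuous_interval_fun_linear) (auto simp: H_def)
  ultimately have w: "abs_continuous_interval_fun w"
    unfolding w_def by (intro abs_continuous_interval_fun_add)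
  have le: "\<bar>F v - F u\<bar> \<le> w u v" if uv: "0 < u" "u \<le> v" "v < 2 * pi" for u v
  proof -
    have i1: "integrable lebesgue (\<lambda>t. g t * indicator (A1 u v) t)"
      "integrable lebesgue (\<lambda>t. g t * indicator (A2 u v) t)"
      using ig by (auto intro!: integrable_real_mult_indicator simp: A1 A2)
    have i0: "integrable lebesgue (\<lambda>t. 2 * L * (v - u) * \<bar>h t\<bar>)" using h by auto
    have "F v - F u = (\<integral>t. h t * W v t - h t * W u t \<partial>lebesgue)"
      unfolding F using uv by (intro Bochner_Integration.integral_diff[symmetric] iW) auto
    also have "\<bar>\<dots>\<bar> \<le> (\<integral>t. \<bar>h t * W v t - h t * W u t\<bar> \<partial>lebesgue)"
      by (rule integral_abs_bound)
    also have "\<dots> \<le> (\<integral>t. 2 * L * (v - u) * \<bar>h t\<bar> + g t * indicator (A1 u v) t + g t * indicator (A2 u v) t \<partial>lebesgue)"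
    proof (rule integral_mono_AE)
      show "integrable lebesgue (\<lambda>t. \<bar>h t * W v t - h t * W u t\<bar>)"
        using uv by (intro integrable_abs Bochner_Integration.integrable_diff iW) auto
      show "integrable lebesgue (\<lambda>t. 2 * L * (v - u) * \<bar>h t\<bar> + g t * indicator (A1 u v) t + g t * indicator (A2 u v) t)"
        by (intro Bochner_Integration.integrable_add i0 i1)
      \<comment> \<open>The sets where the jump terms change are half-open. Removing their closed
        endpoints u/2 and pi - v/2 leaves the open sets \<open>A1 u v\<close> and
        \<open>A2 u v\<close>.\<close>
      have "AE t in lebesgue. t \<notin> {pi - v / 2, u / 2}" by (rule AE_notin) simp
      thus "AE t in lebesgue. \<bar>h t * W v t - h t * W u t\<bar> \<le>
          2 * L * (v - u) * \<bar>h t\<bar> + g t * indicator (A1 u v) t + g t * indicator (A2 u v) t"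
      proof (rule AE_mp, intro AE_I2 impI)
        fix t assume t: "t \<notin> {pi - v / 2, u / 2}"
        show "\<bar>h t * W v t - h t * W u t\<bar> \<le>
          2 * L * (v - u) * \<bar>h t\<bar> + g t * indicator (A1 u v) t + g t * indicator (A2 u v) t"
        proof (cases "t \<in> {0..pi}")
          case True
          have "\<bar>E (2 * t + v) - E (2 * t + u)\<bar> \<le> L * \<bar>(2 * t + v) - (2 * t + u)\<bar>"
            "\<bar>E (2 * t - v) - E (2 * t - u)\<bar> \<le> L * \<bar>(2 * t - v) - (2 * t - u)\<bar>"
            using True uv by (intro lip; simp add: abs_le_iff)+
          hence e: "\<bar>E (2 * t + v) - E (2 * t + u)\<bar> \<le> L * (v - u)"
            "\<bar>E (2 * t - v) - E (2 * t - u)\<bar> \<le> L * (v - u)"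
            using uv by simp_all
          define s where "s = (\<lambda>x. of_bool (2 * pi - x \<le> 2 * t) - of_bool (2 * t < x) :: real)"
          have s: "saw (2 * t + x) + saw (2 * t - x) = pi - 2 * t + pi * s x" if "x \<in> {u, v}" for x
            unfolding s_def using that True uv by (intro saw_plus_saw) auto
          have "\<bar>s v - s u\<bar> \<le> indicator (A1 u v) t + indicator (A2 u v) t"
            using t uv by (auto simp: s_def A1_def A2_def indicator_def of_bool_def)
          hence "pi * \<bar>s v - s u\<bar> \<le> pi * (indicator (A1 u v) t + indicator (A2 u v) t)"
            by (intro mult_left_mono) auto
          hence s': "\<bar>pi * s v - pi * s u\<bar> \<le> pi * (indicator (A1 u v) t + indicator (A2 u v) t)"
            by (simp add: abs_mult right_diff_distrib[symmetric])
          have "\<bar>W v t - W u t\<bar> \<le> 2 * L * (v - u) + pi * (indicator (A1 u v) t + indicator (A2 u v) t)"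
            using e s[of u] s[of v] s' unfolding W_def abs_le_iff by (simp add: algebra_simps)
          hence "\<bar>h t\<bar> * \<bar>W v t - W u t\<bar> \<le> 
              \<bar>h t\<bar> * (2 * L * (v - u) + pi * (indicator (A1 u v) t + indicator (A2 u v) t))"
            by (intro mult_left_mono) auto
          thus ?thesis by (simp add: g_def abs_mult[symmetric] algebra_simps)
        qed (simp add: h g_def)
      qed
    qed
    also have "\<dots> = w u v"
      using i0 i1 by (simp add: w_def H_def)
    finally show ?thesis .
  qed
  show "\<exists>w. abs_continuous_interval_fun w \<and>
      (\<forall>u v. 0 < u \<longrightarrow> u \<le> v \<longrightarrow> v < 2 * pi \<longrightarrow> \<bar>F v - F u\<bar> \<le> w u v)"
    using w le by blast
qed

section \<open>The frequency shifts\<close>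

text \<open>The derivative of arctan x - x is - x^2 / (1 + x^2), which is at most z^2 in absolute
  value between - \<bar>z\<bar> and \<bar>z\<bar>.\<close>

lemma abs_arctan_minus_le: "\<bar>arctan z - z\<bar> \<le> \<bar>z\<bar> ^ 3"
proof -
  have "norm ((arctan z - z) - (arctan 0 - 0)) \<le> \<bar>z\<bar>\<^sup>2 * norm (z - 0)"
  proof (rule field_differentiable_bound[where f' = "\<lambda>x. inverse (1 + x\<^sup>2) - 1"])
    show "convex {- \<bar>z\<bar>..\<bar>z\<bar>}" by simp
    fix x assume "x \<in> {- \<bar>z\<bar>..\<bar>z\<bar>}"
    hence x: "x\<^sup>2 \<le> \<bar>z\<bar>\<^sup>2" using abs_le_square_iff[of x z] by auto
    show "((\<lambda>x. arctan x - x) has_field_derivative (inverse (1 + x\<^sup>2) - 1)) (at x within {- \<bar>z\<bar>..\<bar>z\<bar>})"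
      by (auto intro!: derivative_eq_intros)
    have p: "1 + x\<^sup>2 > 0" using zero_le_power2[of x] by linarith
    have "inverse (1 + x\<^sup>2) - 1 = (1 - (1 + x\<^sup>2)) / (1 + x\<^sup>2)"
      using p unfolding diff_divide_distrib by (simp add: inverse_eq_divide)
    hence "inverse (1 + x\<^sup>2) - 1 = - (x\<^sup>2 / (1 + x\<^sup>2))" by simp
    moreover have "x\<^sup>2 / (1 + x\<^sup>2) \<le> x\<^sup>2 / 1" by (rule divide_left_mono) (use p in auto)
    moreover have "x\<^sup>2 / (1 + x\<^sup>2) \<ge> 0" using p by simp
    ultimately show "norm (inverse (1 + x\<^sup>2) - 1) \<le> \<bar>z\<bar>\<^sup>2" using x by simp
  qed auto
  thus ?thesis by (simp add: power3_eq_cube power2_eq_square abs_mult)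
qed

text \<open>The derivative - a / (t^2 + a^2) is bounded by 1/2 for t \<ge> 1, because 2 t
  \<bar>a\<bar> \<le> t^2 + a^2. The constant does not depend on a, so two such terms divided by pi
  give a contraction.\<close>

lemma arctan_divide_lipschitz:
  fixes a x y :: real
  assumes "x \<ge> 1" "y \<ge> 1"
  shows "\<bar>arctan (a / x) - arctan (a / y)\<bar> \<le> 1 / 2 * \<bar>x - y\<bar>"
proof -
  have "norm (arctan (a / x) - arctan (a / y)) \<le> 1 / 2 * norm (x - y)"
  proof (rule field_differentiable_bound[where S = "{1..}" and f' = "\<lambda>t. - a / (t\<^sup>2 + a\<^sup>2)"])
    fix t :: real assume t: "t \<in> {1..}"
    hence p: "t\<^sup>2 + a\<^sup>2 > 0" by (auto intro: add_pos_nonneg)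
    have "inverse (1 + (a / t)\<^sup>2) * (- a / (t * t)) = - a / (t\<^sup>2 + a\<^sup>2)"
      using t p by (auto simp: field_simps power2_eq_square)
    thus "((\<lambda>t. arctan (a / t)) has_field_derivative - a / (t\<^sup>2 + a\<^sup>2)) (at t within {1..})"
      using t by (auto intro!: derivative_eq_intros)
    have "2 * \<bar>a\<bar> \<le> 2 * t * \<bar>a\<bar>" using t by (simp add: mult_right_mono)
    also have "\<dots> \<le> t\<^sup>2 + a\<^sup>2" using sum_squares_bound[of t "\<bar>a\<bar>"] by simp
    finally show "norm (- a / (t\<^sup>2 + a\<^sup>2)) \<le> 1 / 2"
      using p by (simp add: field_simps)
  qed (use assms in auto)
  thus ?thesis by simp
qed

text \<open>With z = cot \<alpha> / x the quotient is z / sqrt (1 + z^2), which is sin (arctan z) =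
  cos (pi/2 - arctan z).\<close>

lemma arccos_cos_div_sqrt:
  assumes "0 < \<alpha>" "\<alpha> < pi" "x > 0"
  shows "arccos (cos \<alpha> / sqrt (x\<^sup>2 * (sin \<alpha>)\<^sup>2 + (cos \<alpha>)\<^sup>2)) = pi / 2 - arctan (cot \<alpha> / x)"
proof -
  define z where "z = cot \<alpha> / x"
  define p where "p = x * sin \<alpha>"
  have p: "p > 0" using assms sin_gt_zero by (simp add: p_def)
  have pz: "p * z = cos \<alpha>" using p by (auto simp: p_def z_def cot_def)
  have "sqrt (x\<^sup>2 * (sin \<alpha>)\<^sup>2 + (cos \<alpha>)\<^sup>2) = sqrt (p\<^sup>2 * (1 + z\<^sup>2))"
    unfolding pz[symmetric] by (simp add: p_def algebra_simps power_mult_distrib)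
  also have "\<dots> = p * sqrt (1 + z\<^sup>2)" using p by (simp add: real_sqrt_mult)
  finally have "cos \<alpha> / sqrt (x\<^sup>2 * (sin \<alpha>)\<^sup>2 + (cos \<alpha>)\<^sup>2) = z / sqrt (1 + z\<^sup>2)"
    using p unfolding pz[symmetric] by simp
  also have "\<dots> = cos (pi / 2 - arctan z)"
    using sin_arctan[of z] by (simp add: cos_diff)
  also have "arccos \<dots> = pi / 2 - arctan z"
    using arctan_lbound[of z] arctan_ubound[of z] by (intro arccos_cos) linarith+
  finally show ?thesis by (simp add: z_def)
qed

text \<open>Both arccos values lie in [0, pi]. As \<open>d\<close> is arbitrary, this confines every
  fixed point to [-1, 1], where n + d \<ge> 1 for n \<ge> 2.\<close>

lemma abs_delta_rhs_le: "\<bar>delta_rhs \<alpha> \<beta> n d\<bar> \<le> 1"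
proof -
  have le: "- 1 \<le> cos \<theta> / sqrt (X\<^sup>2 * (sin \<theta>)\<^sup>2 + (cos \<theta>)\<^sup>2)"
    "cos \<theta> / sqrt (X\<^sup>2 * (sin \<theta>)\<^sup>2 + (cos \<theta>)\<^sup>2) \<le> 1" for \<theta> X :: real
  proof -
    define r where "r = sqrt (X\<^sup>2 * (sin \<theta>)\<^sup>2 + (cos \<theta>)\<^sup>2)"
    have "\<bar>cos \<theta>\<bar> = sqrt ((cos \<theta>)\<^sup>2)" by simp
    also have "\<dots> \<le> r" unfolding r_def by (rule real_sqrt_le_mono) simp
    finally have "\<bar>cos \<theta>\<bar> \<le> \<bar>r\<bar>" by simp
    hence "\<bar>cos \<theta> / r\<bar> \<le> 1" unfolding abs_divide by (simp add: divide_le_eq_1)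
    thus "- 1 \<le> cos \<theta> / sqrt (X\<^sup>2 * (sin \<theta>)\<^sup>2 + (cos \<theta>)\<^sup>2)"
      "cos \<theta> / sqrt (X\<^sup>2 * (sin \<theta>)\<^sup>2 + (cos \<theta>)\<^sup>2) \<le> 1"
      unfolding abs_le_iff r_def by linarith+
  qed
  define A where "A = arccos (cos \<alpha> / sqrt ((real n + d)\<^sup>2 * (sin \<alpha>)\<^sup>2 + (cos \<alpha>)\<^sup>2))"
  define B where "B = arccos (cos \<beta> / sqrt ((real n + d)\<^sup>2 * (sin \<beta>)\<^sup>2 + (cos \<beta>)\<^sup>2))"
  have "0 \<le> A" "A \<le> pi" "0 \<le> B" "B \<le> pi"
    using arccos[OF le] unfolding A_def B_def by blast+
  hence "\<bar>A - B\<bar> \<le> pi" by linarith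
  moreover have "delta_rhs \<alpha> \<beta> n d = (A - B) / pi"
    by (simp add: delta_rhs_def A_def B_def diff_divide_distrib)
  ultimately show ?thesis by simp
qed

lemma delta_rhs_arctan:
  assumes "\<alpha> \<in> {0<..<pi}" "\<beta> \<in> {0<..<pi}" "real n + d > 0"
  shows "delta_rhs \<alpha> \<beta> n d = (arctan (cot \<beta> / (real n + d)) - arctan (cot \<alpha> / (real n + d))) / pi"
  using assms by (simp add: delta_rhs_def arccos_cos_div_sqrt diff_divide_distrib)

text \<open>The definite description is justified here: existence by the intermediate value theorem
  on [-1, 1], uniqueness because the right-hand side contracts distances by the factor 1 /
  pi.\<close>

lemma delta_fixed_point:
  assumes \<alpha>: "\<alpha> \<in> {0<..<pi}" and \<beta>: "\<beta> \<in> {0<..<pi}" and n: "n \<ge> 2"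
  shows "delta \<alpha> \<beta> n = delta_rhs \<alpha> \<beta> n (delta \<alpha> \<beta> n)"
proof -
  have ge: "real n + d \<ge> 1" if "\<bar>d\<bar> \<le> 1" for d using that n by linarith
  have rhs: "delta_rhs \<alpha> \<beta> n d = (arctan (cot \<beta> / (real n + d)) - arctan (cot \<alpha> / (real n + d))) / pi"
    if "\<bar>d\<bar> \<le> 1" for d
    using ge[OF that] by (intro delta_rhs_arctan \<alpha> \<beta>) auto
  have "\<exists>!d. d = delta_rhs \<alpha> \<beta> n d"
  proof (rule ex_ex1I)
    have "continuous_on {-1..1} (\<lambda>d. d - (arctan (cot \<beta> / (real n + d)) - arctan (cot \<alpha> / (real n + d))) / pi)"
      using n by (intro continuous_intros) auto
    hence "continuous_on {-1..1} (\<lambda>d. d - delta_rhs \<alpha> \<beta> n d)"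
      by (rule continuous_on_eq) (use rhs in auto)
    hence "\<exists>d. -1 \<le> d \<and> d \<le> 1 \<and> d - delta_rhs \<alpha> \<beta> n d = 0"
      using abs_delta_rhs_le[of \<alpha> \<beta> n "-1"] abs_delta_rhs_le[of \<alpha> \<beta> n 1]
      by (intro IVT') auto
    thus "\<exists>d. d = delta_rhs \<alpha> \<beta> n d" by auto
  next
    fix d d' assume d: "d = delta_rhs \<alpha> \<beta> n d" and d': "d' = delta_rhs \<alpha> \<beta> n d'"
    have 1: "\<bar>d\<bar> \<le> 1" "\<bar>d'\<bar> \<le> 1"
      using abs_delta_rhs_le[of \<alpha> \<beta> n d] abs_delta_rhs_le[of \<alpha> \<beta> n d'] d d' by simp_all
    define A where "A = (\<lambda>d. arctan (cot \<alpha> / (real n + d)))"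
    define B where "B = (\<lambda>d. arctan (cot \<beta> / (real n + d)))"
    have "d = (B d - A d) / pi" "d' = (B d' - A d') / pi"
      using d d' rhs[OF 1(1)] rhs[OF 1(2)] by (simp_all add: A_def B_def)
    hence "pi * d = B d - A d" "pi * d' = B d' - A d'" by (simp_all add: field_simps)
    hence "\<bar>pi * d - pi * d'\<bar> = \<bar>(B d - B d') - (A d - A d')\<bar>" by simp
    also have "\<dots> \<le> \<bar>B d - B d'\<bar> + \<bar>A d - A d'\<bar>" by (rule abs_triangle_ineq4)
    also have "\<dots> \<le> 1 / 2 * \<bar>d - d'\<bar> + 1 / 2 * \<bar>d - d'\<bar>"
      using arctan_divide_lipschitz[OF ge[OF 1(1)] ge[OF 1(2)], of "cot \<beta>"]
        arctan_divide_lipschitz[OF ge[OF 1(1)] ge[OF 1(2)], of "cot \<alpha>"]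
      unfolding A_def B_def by (intro add_mono) simp_all
    finally have "\<bar>pi * d - pi * d'\<bar> \<le> \<bar>d - d'\<bar>" by simp
    hence "pi * \<bar>d - d'\<bar> \<le> 1 * \<bar>d - d'\<bar>"
      by (simp add: right_diff_distrib[symmetric] abs_mult)
    hence "\<not> 0 < \<bar>d - d'\<bar>" using pi_gt3 mult_right_le_imp_le[of pi "\<bar>d - d'\<bar>" 1] by auto
    thus "d = d'" by simp
  qed
  thus ?thesis unfolding delta_def by (rule theI')
qed

lemma abs_delta_le:
  assumes "\<alpha> \<in> {0<..<pi}" "\<beta> \<in> {0<..<pi}" "n \<ge> 2"
  shows "\<bar>delta \<alpha> \<beta> n\<bar> \<le> 1"
  using delta_fixed_point[OF assms] abs_delta_rhs_le by metis

text \<open>Two replacements are made: arctan by its argument, with a cubic error, and then 1 / (n +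
  \<delta>) by 1 / n.\<close>

lemma delta_asymp:
  fixes \<alpha> \<beta> :: real
  assumes \<alpha>: "\<alpha> \<in> {0<..<pi}" and \<beta>: "\<beta> \<in> {0<..<pi}" and n: "n \<ge> 2"
  defines "c \<equiv> (cot \<beta> - cot \<alpha>) / pi"
  shows "\<bar>delta \<alpha> \<beta> n - c / real n\<bar> \<le> (4 * (\<bar>cot \<alpha>\<bar> ^ 3 + \<bar>cot \<beta>\<bar> ^ 3) + 2 * \<bar>c\<bar>) / (real n)\<^sup>2"
proof -
  define d where "d = delta \<alpha> \<beta> n"
  define x where "x = real n + d"
  define a where "a = cot \<alpha>"
  define b where "b = cot \<beta>"
  have d: "\<bar>d\<bar> \<le> 1" using abs_delta_le[OF \<alpha> \<beta> n] by (simp add: d_def)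
  have x: "x \<ge> 1" "x \<ge> real n / 2" using d n by (auto simp: x_def)
  \<comment> \<open>Since x \<ge> 1, the cube dominates the square, and x \<ge> n/2 supplies the
    factor 4.\<close>
  have inv_cube: "1 / x ^ 3 \<le> 4 / (real n)\<^sup>2"
  proof -
    have "x\<^sup>2 \<le> x ^ 3" using x by (intro power_increasing) auto
    moreover have "(real n / 2)\<^sup>2 \<le> x\<^sup>2" using x by (intro power_mono) auto
    ultimately have "(real n / 2)\<^sup>2 \<le> x ^ 3" by linarith
    hence "1 / x ^ 3 \<le> 1 / (real n / 2)\<^sup>2" using n x by (intro divide_left_mono) auto
    thus ?thesis by (simp add: power_divide)
  qed
  have "d = (arctan (b / x) - arctan (a / x)) / pi"
    using delta_fixed_point[OF \<alpha> \<beta> n] delta_rhs_arctan[OF \<alpha> \<beta>, of n d] x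
    by (simp add: d_def x_def a_def b_def)
  hence "d - c / x = ((arctan (b / x) - b / x) - (arctan (a / x) - a / x)) / pi"
    by (simp add: c_def a_def b_def diff_divide_distrib mult.commute)
  hence "\<bar>d - c / x\<bar> = \<bar>(arctan (b / x) - b / x) - (arctan (a / x) - a / x)\<bar> / pi" by simp
  also have "\<dots> \<le> \<bar>(arctan (b / x) - b / x) - (arctan (a / x) - a / x)\<bar> / 1"
    using pi_gt3 by (intro divide_left_mono) auto
  also have "\<dots> \<le> \<bar>b / x\<bar> ^ 3 + \<bar>a / x\<bar> ^ 3"
    using order_trans[OF abs_triangle_ineq4 add_mono[OF abs_arctan_minus_le[of "b / x"] abs_arctan_minus_le[of "a / x"]]]
    by simp
  also have "\<dots> = (\<bar>a\<bar> ^ 3 + \<bar>b\<bar> ^ 3) * (1 / x ^ 3)"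
    using x by (simp add: power_divide add_divide_distrib)
  also have "\<dots> \<le> (\<bar>a\<bar> ^ 3 + \<bar>b\<bar> ^ 3) * (4 / (real n)\<^sup>2)"
    using inv_cube by (intro mult_left_mono) auto
  finally have 1: "\<bar>d - c / x\<bar> \<le> 4 * (\<bar>a\<bar> ^ 3 + \<bar>b\<bar> ^ 3) / (real n)\<^sup>2" by (simp add: mult.commute)
  \<comment> \<open>The numerator uses x - n = d, and \<bar>d\<bar> \<le> 1 with x \<ge> n/2 makes
    the difference O(1/n^2).\<close>
  have "c / x - c / real n = - (c * d) / (x * real n)"
    using x n by (simp add: x_def field_simps)
  hence "\<bar>c / x - c / real n\<bar> = \<bar>c\<bar> * \<bar>d\<bar> / (x * real n)" using x by (simp add: abs_mult)
  also have "\<dots> \<le> \<bar>c\<bar> * 1 / (real n / 2 * real n)"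
    using d x n by (intro frac_le mult_left_mono mult_right_mono) auto
  also have "\<dots> = 2 * \<bar>c\<bar> / (real n)\<^sup>2" by (simp add: power2_eq_square)
  finally have "\<bar>d - c / real n\<bar> \<le> 4 * (\<bar>a\<bar> ^ 3 + \<bar>b\<bar> ^ 3) / (real n)\<^sup>2 + 2 * \<bar>c\<bar> / (real n)\<^sup>2"
    using 1 by linarith
  thus ?thesis by (simp add: a_def b_def d_def add_divide_distrib)
qed

text \<open>Both sines vanish, so the right-hand side is the constant (arccos (-1) - arccos 1) / pi
  = 1, whatever d is.\<close>

lemma delta_pi_0: "delta pi 0 n = 1"
  by (simp add: delta_def delta_rhs_def)

section \<open>The series\<close>

lemma freq_sum_measurable[measurable]: "freq_sum \<omega> N \<in> borel_measurable borel"
  unfolding freq_sum_def[abs_def] by measurable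

text \<open>The frequencies run through 3, 4, ..., so only the first two terms of the sawtooth
  series are missing.\<close>

lemma freq_sum_shift_by_one:
  assumes "\<And>n. n \<ge> 2 \<Longrightarrow> \<omega> n = real n + 1"
  shows "freq_sum \<omega> N y = saw_sum (N + 2) y + (- sin y - sin (2 * y) / 2)"
proof -
  have "freq_sum \<omega> N y = (\<Sum>m<N. sin (real (Suc (Suc (Suc m))) * y) / real (Suc (Suc (Suc m))))"
    unfolding freq_sum_def by (intro sum.cong refl) (simp add: assms algebra_simps)
  moreover have "saw_sum (N + 2) y = sin y + sin (2 * y) / 2 +
      (\<Sum>m<N. sin (real (Suc (Suc (Suc m))) * y) / real (Suc (Suc (Suc m))))"
    by (simp add: saw_sum_def sum.lessThan_Suc_shift del: sum.lessThan_Suc)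
  ultimately show ?thesis by simp
qed

text \<open>This puts both parameter cases into the form required by the kernel lemmas. The second
  case is treated directly, because its frequency shift is constantly 1 and does not decay.\<close>

lemma freq_sum_sawtooth:
  fixes \<alpha> \<beta> R :: real
  assumes "(\<alpha> \<in> {0<..<pi} \<and> \<beta> \<in> {0<..<pi}) \<or> (\<alpha> = pi \<and> \<beta> = 0)"
  defines "\<omega> \<equiv> \<lambda>n. real n + delta \<alpha> \<beta> n"
  obtains E B L where "E \<in> borel_measurable borel"
    and "\<And>N y. \<bar>y\<bar> \<le> R \<Longrightarrow> \<bar>freq_sum \<omega> N y\<bar> \<le> B"
    and "\<And>u v. \<bar>u\<bar> \<le> R \<Longrightarrow> \<bar>v\<bar> \<le> R \<Longrightarrow> \<bar>E v - E u\<bar> \<le> L * \<bar>v - u\<bar>"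
    and "\<And>y. sin (y / 2) \<noteq> 0 \<Longrightarrow> (\<lambda>N. freq_sum \<omega> N y) \<longlonglongrightarrow> saw y + E y"
  using assms(1)
proof
  assume ab: "\<alpha> \<in> {0<..<pi} \<and> \<beta> \<in> {0<..<pi}"
  define c where "c = (cot \<beta> - cot \<alpha>) / pi"
  define C where "C = 4 * (\<bar>cot \<alpha>\<bar> ^ 3 + \<bar>cot \<beta>\<bar> ^ 3) + 2 * \<bar>c\<bar>"
  interpret asymptotic_frequencies \<omega> c C
  proof
    fix n :: nat assume n: "n \<ge> 2"
    show "\<omega> n \<ge> 1" using abs_delta_le[of \<alpha> \<beta> n] ab n by (simp add: \<omega>_def abs_le_iff)
    show "\<bar>\<omega> n - real n - c / real n\<bar> \<le> C / (real n)\<^sup>2"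
      using delta_asymp[of \<alpha> \<beta> n] ab n by (simp add: \<omega>_def c_def C_def)
  qed
  define L where "L = 11 * \<bar>c\<bar> * R + ((\<bar>c\<bar> + C)\<^sup>2 * R\<^sup>2 + C * R)"
  show thesis
  \<comment> \<open>The missing term n = 1 of the sawtooth series puts - sin y into \<open>E\<close>
    and adds 1 to the Lipschitz constant.\<close>
  proof (rule that[of "\<lambda>y. diff_sum y - sin y" "11 + (\<bar>c\<bar> + C) * (1 + R)" "L + 1"])
    show "(\<lambda>y. diff_sum y - sin y) \<in> borel_measurable borel"
      using diff_sum_measurable by measurable
    show "\<bar>freq_sum \<omega> N y\<bar> \<le> 11 + (\<bar>c\<bar> + C) * (1 + R)" if "\<bar>y\<bar> \<le> R" for N y
      using C_nonneg that by (intro order_trans[OF freq_sum_le] add_left_mono mult_left_mono) auto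
    show "\<bar>(diff_sum v - sin v) - (diff_sum u - sin u)\<bar> \<le> (L + 1) * \<bar>v - u\<bar>"
      if "\<bar>u\<bar> \<le> R" "\<bar>v\<bar> \<le> R" for u v
    proof -
      have "\<bar>diff_sum v - diff_sum u\<bar> \<le> L * \<bar>v - u\<bar>"
        unfolding L_def by (rule diff_sum_lipschitz[OF that])
      thus ?thesis using abs_sin_diff_le[of v u] by (simp add: distrib_right abs_le_iff)
    qed
  qed (rule freq_sum_tendsto)
next
  assume "\<alpha> = pi \<and> \<beta> = 0"
  hence eq: "freq_sum \<omega> N y = saw_sum (N + 2) y + (- sin y - sin (2 * y) / 2)" for N y
    by (intro freq_sum_shift_by_one) (simp add: \<omega>_def delta_pi_0)
  show thesis
  proof (rule that[of "\<lambda>y. - sin y - sin (2 * y) / 2" 12 2])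
    show "\<bar>freq_sum \<omega> N y\<bar> \<le> 12" for N y
      using saw_sum_bounded[of "N + 2" y] abs_sin_le_one[of y] abs_sin_le_one[of "2 * y"]
      unfolding eq by linarith
    show "\<bar>(- sin v - sin (2 * v) / 2) - (- sin u - sin (2 * u) / 2)\<bar> \<le> 2 * \<bar>v - u\<bar>" for u v :: real
      using abs_sin_diff_le[of v u] abs_sin_diff_le[of "2 * v" "2 * u"]
      unfolding right_diff_distrib[symmetric] abs_mult by (simp add: abs_le_iff)
    show "(\<lambda>N. freq_sum \<omega> N y) \<longlonglongrightarrow> saw y + (- sin y - sin (2 * y) / 2)" if "sin (y / 2) \<noteq> 0" for y
      unfolding eq by (intro tendsto_intros LIMSEQ_ignore_initial_segment saw_sum_tendsto_saw that)
  qed measurable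
qed

text \<open>The product formula for 2 sin cos applies under the integral, and the finite sum is
  exchanged by linearity. Its factor 1/2 and the 1/2 in \<open>kappa\<close> make up the 1/4. The
  indicator in \<open>h\<close> turns the set integral into one over the whole line.\<close>

lemma sum_k_term_eq:
  fixes q :: "real \<Rightarrow> real" and \<alpha> \<beta> :: real
  defines "\<omega> \<equiv> \<lambda>n. real n + delta \<alpha> \<beta> n"
    and "h \<equiv> \<lambda>t. indicator {0..pi} t * ((pi - t) * q t)"
  assumes h: "integrable lebesgue h"
  shows "(\<Sum>m<N. k_term q \<alpha> \<beta> (m + 2) x) =
    - (1 / 4) * (\<integral>t. h t * (freq_sum \<omega> N (2 * t + x) + freq_sum \<omega> N (2 * t - x)) \<partial>lebesgue)"
proof -
  define s where "s = (\<lambda>m. cos (\<omega> (m + 2) * x) / \<omega> (m + 2))"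
  have int: "integrable lebesgue (\<lambda>t. h t * sin (2 * w * t))" for w
  proof (rule Bochner_Integration.integrable_bound[OF h])
    have "(\<lambda>t. sin (2 * w * t)) \<in> borel_measurable lebesgue"
      by (intro measurable_completion) measurable
    thus "(\<lambda>t. h t * sin (2 * w * t)) \<in> borel_measurable lebesgue"
      using h by (intro borel_measurable_times) auto
    show "AE t in lebesgue. norm (h t * sin (2 * w * t)) \<le> norm (h t)"
      by (intro AE_I2) (simp add: abs_mult mult_left_le)
  qed
  have "k_term q \<alpha> \<beta> (m + 2) x = (\<integral>t. - (1 / 2) * s m * (h t * sin (2 * \<omega> (m + 2) * t)) \<partial>lebesgue)" for m
  proof -
    have "kappa q \<alpha> \<beta> (m + 2) = - (1 / 2) * (\<integral>t. h t * sin (2 * \<omega> (m + 2) * t) \<partial>lebesgue)"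
      unfolding kappa_def set_lebesgue_integral_def h_def \<omega>_def by (simp add: mult.assoc)
    thus ?thesis by (simp add: k_term_def s_def \<omega>_def)
  qed
  moreover have "(\<Sum>m<N. - (1 / 2) * s m * (h t * sin (2 * \<omega> (m + 2) * t))) =
      - (1 / 4) * (h t * (freq_sum \<omega> N (2 * t + x) + freq_sum \<omega> N (2 * t - x)))" for t
  proof -
    have "2 * s m * sin (2 * \<omega> (m + 2) * t) = sin (\<omega> (m + 2) * (2 * t + x)) / \<omega> (m + 2) +
        sin (\<omega> (m + 2) * (2 * t - x)) / \<omega> (m + 2)" for m
    proof -
      have "\<omega> (m + 2) * (2 * t + x) = 2 * \<omega> (m + 2) * t + \<omega> (m + 2) * x"
        "\<omega> (m + 2) * (2 * t - x) = 2 * \<omega> (m + 2) * t - \<omega> (m + 2) * x" by (simp_all add: algebra_simps)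
      thus ?thesis by (simp only: s_def sin_add sin_diff) (simp add: add_divide_distrib[symmetric])
    qed
    hence "freq_sum \<omega> N (2 * t + x) + freq_sum \<omega> N (2 * t - x) = (\<Sum>m<N. 2 * s m * sin (2 * \<omega> (m + 2) * t))"
      by (simp add: freq_sum_def sum.distrib)
    thus ?thesis by (simp add: sum_distrib_left mult_ac)
  qed
  moreover have "(\<Sum>m<N. \<integral>t. - (1 / 2) * s m * (h t * sin (2 * \<omega> (m + 2) * t)) \<partial>lebesgue) =
      (\<integral>t. (\<Sum>m<N. - (1 / 2) * s m * (h t * sin (2 * \<omega> (m + 2) * t))) \<partial>lebesgue)"
    using int by (intro Bochner_Integration.integral_sum[symmetric] integrable_mult_right) auto
  ultimately show ?thesis by simp
qed

theorem theorem1p2: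
  fixes q :: "real \<Rightarrow> real" and \<alpha> \<beta> :: real
  assumes "set_integrable lebesgue {0..pi} q"
    and "(\<alpha> \<in> {0<..<pi} \<and> \<beta> \<in> {0<..<pi}) \<or> (\<alpha> = pi \<and> \<beta> = 0)"
  shows "(\<forall>x\<in>{0<..<2 * pi}. summable (\<lambda>m. k_term q \<alpha> \<beta> (m + 2) x))
       \<and> k_fun q \<alpha> \<beta> \<in> AC_open 0 (2 * pi)"
proof -
  define \<omega> where "\<omega> = (\<lambda>n. real n + delta \<alpha> \<beta> n)"
  define h where "h = (\<lambda>t. indicator {0..pi} t * ((pi - t) * q t))"
  have h: "integrable lebesgue h"
  proof (rule Bochner_Integration.integrable_bound)
    have iq: "integrable lebesgue (\<lambda>t. indicator {0..pi} t * q t)"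
      using assms(1) by (simp add: set_integrable_def)
    thus "integrable lebesgue (\<lambda>t. pi * (indicator {0..pi} t * q t))" by simp
    have "(\<lambda>t. pi - t) \<in> borel_measurable lebesgue" by (intro measurable_completion) measurable
    hence "(\<lambda>t. (pi - t) * (indicator {0..pi} t * q t)) \<in> borel_measurable lebesgue"
      by (rule borel_measurable_times) (use iq in \<open>rule borel_measurable_integrable\<close>)
    \<comment> \<open>The hypothesis gives measurability of \<open>q\<close> only after
      multiplication with the indicator, so these two factors are kept together.\<close>
    moreover have "h = (\<lambda>t. (pi - t) * (indicator {0..pi} t * q t))" by (auto simp: h_def)
    ultimately show "h \<in> borel_measurable lebesgue" by simp
    show "AE t in lebesgue. norm (h t) \<le> norm (pi * (indicator {0..pi} t * q t))"
      by (intro AE_I2) (auto simp: h_def indicator_def abs_mult intro!: mult_right_mono)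
  qed
  have h0: "h t = 0" if "t \<notin> {0..pi}" for t using that by (simp add: h_def)
  obtain E B L where E: "E \<in> borel_measurable borel"
    "\<And>N y. \<bar>y\<bar> \<le> 4 * pi \<Longrightarrow> \<bar>freq_sum \<omega> N y\<bar> \<le> B"
    "\<And>u v. \<bar>u\<bar> \<le> 4 * pi \<Longrightarrow> \<bar>v\<bar> \<le> 4 * pi \<Longrightarrow> \<bar>E v - E u\<bar> \<le> L * \<bar>v - u\<bar>"
    "\<And>y. sin (y / 2) \<noteq> 0 \<Longrightarrow> (\<lambda>N. freq_sum \<omega> N y) \<longlonglongrightarrow> saw y + E y"
    unfolding \<omega>_def using freq_sum_sawtooth[OF assms(2), of "4 * pi"] by blast
  define F where "F = (\<lambda>x. \<integral>t. h t * (saw (2 * t + x) + E (2 * t + x) + (saw (2 * t - x) + E (2 * t - x))) \<partial>lebesgue)"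
  note kernel = h h0 freq_sum_measurable E(2,1,3,4)
  have sums: "(\<lambda>m. k_term q \<alpha> \<beta> (m + 2) x) sums (- (1 / 4) * F x)" if x: "x \<in> {0<..<2 * pi}" for x
  proof -
    have "(\<Sum>m<N. k_term q \<alpha> \<beta> (m + 2) x) =
        - (1 / 4) * (\<integral>t. h t * (freq_sum \<omega> N (2 * t + x) + freq_sum \<omega> N (2 * t - x)) \<partial>lebesgue)" for N
      using sum_k_term_eq[OF h[unfolded h_def]] by (simp only: h_def \<omega>_def)
    thus ?thesis
      unfolding sums_def F_def
      by (simp only:) (intro tendsto_mult tendsto_const saw_kernel_integral_tendsto[OF kernel x])
  qed
  obtain w where w: "abs_continuous_interval_fun w"
    "\<And>u v. 0 < u \<Longrightarrow> u \<le> v \<Longrightarrow> v < 2 * pi \<Longrightarrow> \<bar>F v - F u\<bar> \<le> w u v"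
    using saw_kernel_integral_variation[OF kernel] unfolding F_def by blast
  \<comment> \<open>Convergence is what gives the infinite sum in \<open>k_fun\<close> its intended
    value on (0, 2 pi).\<close>
  have k: "k_fun q \<alpha> \<beta> x = - (1 / 4) * F x" if "x \<in> {0<..<2 * pi}" for x
    unfolding k_fun_def by (rule sums_unique[symmetric, OF sums[OF that]])
  \<comment> \<open>The factor 1/4 only decreases the increments of \<open>F\<close>, so the
    majorant \<open>w\<close> serves for \<open>k_fun\<close> too.\<close>
  have "\<bar>k_fun q \<alpha> \<beta> v - k_fun q \<alpha> \<beta> u\<bar> \<le> w u v" if "0 < u" "u \<le> v" "v < 2 * pi" for u v
    using w(2)[OF that] that by (simp add: k abs_le_iff)
  hence "k_fun q \<alpha> \<beta> \<in> AC_open 0 (2 * pi)"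
    unfolding AC_open_def by (auto intro!: abs_continuous_on_segmentI[OF w(1)])
  thus ?thesis using sums sums_summable by blast
qed

end
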